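(* Let $q\ge2$, let $n_1,\dots,n_q\ge1$ be integers, $n=\sum_{k=1}^q n_k$, and let $Z$ be the $n\times q$ block-diagonal matrix with diagonal blocks $\mathbf 1_{n_1},\dots,\mathbf 1_{n_q}$. Let $W$ be a real $n\times p$ matrix of rank $p<n$ with $\mathbf 1_n\in\mathcal M(W)$. Consider the model $Y\sim N(X\beta,\ \sigma_1^2V+\sigma_2^2I_n)$ with $X=W$ and $V=ZZ'$, and let $M=I_n-XX^{+}$. (a) If $\mathcal M([X,V])\subsetneq\mathbb R^n$, then the ML degree of the model does not exceed $3q-3$. (b) If $\mathcal M(MV)\subsetneq\mathcal M(M)$, then the REML degree of the model does not exceed $2q-3$.
   Context: For a matrix $A$, $A'$ is its transpose, $A^{+}$ its Moore-Penrose inverse, $\mathcal M(A)$ its column space; $[X,V]$ is the block matrix with blocks $X$ and $V$; $\mathbf 1_m$ is the column vector of $m$ ones. The model is the extension of the one-way random effects model $Y=W\beta+Z\alpha+\epsilon$ with $\beta\in\mathbb R^p$ fixed and $\alpha\sim N(\mathbf 0_q,\sigma_1^2I_q)$, $\epsilon\sim N(\mathbf 0_n,\sigma_2^2I_n)$ independent, $\sigma_1^2\ge0$, $\sigma_2^2>0$. Put $\Sigma=\Sigma(s)=\sigma_1^2V+\sigma_2^2I_n$, $s=(\sigma_1^2,\sigma_2^2)'$. ML degree. Up to an additive constant, twice the log-likelihood is $-\log|\Sigma|-(Y-X\beta)'\Sigma^{-1}(Y-X\beta)$. Setting its partial derivatives with respect to $\beta,\sigma_1^2,\sigma_2^2$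 (computed as for real variables) to zero at $Y=y$ gives the ML equations $$X'\Sigma^{-1}(y-X\beta)=0,\quad \operatorname{tr}(\Sigma^{-1}V)=(y-X\beta)'\Sigma^{-1}V\Sigma^{-1}(y-X\beta),\quad \operatorname{tr}(\Sigma^{-1})=(y-X\beta)'\Sigma^{-2}(y-X\beta).$$ A complex solution is $(\beta,s)\in\mathbb C^p\times\mathbb C^2$ with $\Sigma(s)$ invertible satisfying these equations ($'$ is plain transpose). The ML degree is the number of complex solutions for generic data; "the ML degree does not exceed $N$" means that for Lebesgue-almost every $y\in\mathbb R^n$ there are at most $N$ complex solutions. REML degree. Let $B$ be any $(n-p)\times n$ matrix with $BB'=I_{n-p}$, $B'B=M$. The REML degree is the ML degree of the model $z=BY\sim N(\mathbf 0_{n-p},\Omega)$, $\Omega=\sigma_1^2U+\sigma_2^2I_{n-p}$, $U=BVB'$, whose ML equations are $\operatorname{tr}(\Omega^{-1}U)=z'\Omega^{-1}U\Omega^{-1}z$ and $\operatorname{tr}(\Omega^{-1})=z'\Omega^{-2}z$; complex solutions are points $(\sigma_1^2,\sigma_2^2)\in\mathbb C^2$ with $\Omega$ invertible satisfying them. "The REML degree does not exceed $N$" means that for Lebesgue-almost every $z\in\mathbb R^{n-p}$ there are at most $N$ complex solutions.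
   Formalization: Part (b) additionally assumes MV ≠ 0; if MV = 0 then U = BVB' = 0, the first REML equation is vacuous and σ_1² is free, so there are infinitely many solutions and the stated bound fails (e.g. q = 2, n_1 = n_2 = 2, W = Z). *)

theory Defs
  imports
    "HOL-Analysis.Analysis"
    "Jordan_Normal_Form.DL_Rank"
    "Jordan_Normal_Form.Gauss_Jordan_Elimination"
begin

hide_const (open) Finite_Cartesian_Product.vec Finite_Cartesian_Product.mat

definition mat_trace :: "'a :: comm_monoid_add mat \<Rightarrow> 'a" where
  "mat_trace A = (\<Sum>i<dim_row A. A $$ (i, i))"

definition column_space :: "real mat \<Rightarrow> real Matrix.vec set" where
  "column_space A = vec_space.col_space (dim_row A) A"

definition is_pseudoinverse :: "real mat \<Rightarrow> real mat \<Rightarrow> bool" where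
  "is_pseudoinverse A G \<longleftrightarrow>
     G \<in> carrier_mat (dim_col A) (dim_row A) \<and>
     A * G * A = A \<and> G * A * G = G \<and>
     transpose_mat (A * G) = A * G \<and> transpose_mat (G * A) = G * A"

definition pseudoinverse :: "real mat \<Rightarrow> real mat" where
  "pseudoinverse A = (THE G. is_pseudoinverse A G)"

definition append_columns :: "'a mat \<Rightarrow> 'a mat \<Rightarrow> 'a mat" where
  "append_columns A B = mat_of_cols (dim_row A) (cols A @ cols B)"

definition ones_vec :: "nat \<Rightarrow> real Matrix.vec" where
  "ones_vec m = Matrix.vec m (\<lambda>_. 1)"

definition group_design :: "nat list \<Rightarrow> real mat" where
  "group_design ns = diag_block_mat (map (\<lambda>k. mat_of_cols k [ones_vec k]) ns)"

definition covariance :: "real mat \<Rightarrow> complex \<times> complex \<Rightarrow> complex mat" where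
  "covariance V s =
     fst s \<cdot>\<^sub>m map_mat complex_of_real V + snd s \<cdot>\<^sub>m 1\<^sub>m (dim_row V)"

text \<open>The transposes in the likelihood equations are not conjugated when the unknowns
  become complex, so quadratic forms use the bilinear product \<^const>\<open>scalar_prod\<close>.
  \<^term>\<open>the (mat_inverse A)\<close> is the inverse of \<open>A\<close> when \<open>A\<close> is invertible, which is required of
  the covariance matrix of every solution.\<close>

definition ml_solutions ::
  "real mat \<Rightarrow> real mat \<Rightarrow> real Matrix.vec \<Rightarrow> (complex Matrix.vec \<times> (complex \<times> complex)) set" where
  "ml_solutions X V y =
     {(\<beta>, s).
        \<beta> \<in> carrier_vec (dim_col X) \<and>
        invertible_mat (covariance V s) \<and>
        (let Xc = map_mat complex_of_real X;
             Vc = map_mat complex_of_real V;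
             S = the (mat_inverse (covariance V s));
             r = map_vec complex_of_real y - Xc *\<^sub>v \<beta>
         in transpose_mat Xc *\<^sub>v (S *\<^sub>v r) = 0\<^sub>v (dim_col X) \<and>
            mat_trace (S * Vc) = scalar_prod r ((S * Vc * S) *\<^sub>v r) \<and>
            mat_trace S = scalar_prod r ((S * S) *\<^sub>v r))}"

text \<open>Lebesgue measure on \<open>\<real>\<^sup>n\<close> is the product of \<open>n\<close> copies of \<^term>\<open>lborel\<close>.\<close>

definition ml_degree_le :: "real mat \<Rightarrow> real mat \<Rightarrow> nat \<Rightarrow> bool" where
  "ml_degree_le X V N \<longleftrightarrow>
     (AE y in Pi\<^sub>M {..<dim_row X} (\<lambda>_. lborel).
        finite (ml_solutions X V (Matrix.vec (dim_row X) y)) \<and>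
        card (ml_solutions X V (Matrix.vec (dim_row X) y)) \<le> N)"

definition centered_ml_solutions ::
  "real mat \<Rightarrow> real Matrix.vec \<Rightarrow> (complex \<times> complex) set" where
  "centered_ml_solutions U z =
     {s. invertible_mat (covariance U s) \<and>
        (let Uc = map_mat complex_of_real U;
             zc = map_vec complex_of_real z;
             S = the (mat_inverse (covariance U s))
         in mat_trace (S * Uc) = scalar_prod zc ((S * Uc * S) *\<^sub>v zc) \<and>
            mat_trace S = scalar_prod zc ((S * S) *\<^sub>v zc))}"

definition centered_ml_degree_le :: "real mat \<Rightarrow> nat \<Rightarrow> bool" where
  "centered_ml_degree_le U N \<longleftrightarrow>
     (AE z in Pi\<^sub>M {..<dim_row U} (\<lambda>_. lborel).
        finite (centered_ml_solutions U (Matrix.vec (dim_row U) z)) \<and>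
        card (centered_ml_solutions U (Matrix.vec (dim_row U) z)) \<le> N)"

definition residual_projection :: "real mat \<Rightarrow> real mat" where
  "residual_projection X = 1\<^sub>m (dim_row X) - X * pseudoinverse X"

text \<open>The bound is demanded for every admissible \<open>B\<close>. If \<open>B V B' = 0\<close>, the first of the two
  equations of the transformed model is vacuous and the second leaves \<open>\<sigma>\<^sub>1\<^sup>2\<close> free, so that
  no finite bound holds.\<close>

definition reml_degree_le :: "real mat \<Rightarrow> real mat \<Rightarrow> nat \<Rightarrow> bool" where
  "reml_degree_le X V N \<longleftrightarrow>
     (\<forall>B \<in> carrier_mat (dim_row X - dim_col X) (dim_row X).
        B * transpose_mat B = 1\<^sub>m (dim_row X - dim_col X) \<and>
        transpose_mat B * B = residual_projection X \<longrightarrow>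
        centered_ml_degree_le (B * V * transpose_mat B) N)"

end

theory Submission
  imports
    Defs
    "Jordan_Normal_Form.Schur_Decomposition"
    "Jordan_Normal_Form.Spectral_Radius"
begin

text \<open>Diagonalizing \<open>V\<close>, with eigenvalues \<open>\<mu>\<^sub>j\<close>, and its compression to the residual space \<open>\<M>(M)\<close>,
  with eigenvalues \<open>\<lambda>\<^sub>i\<close>, turns the likelihood equations into rational equations in \<open>\<sigma>\<^sub>1\<^sup>2, \<sigma>\<^sub>2\<^sup>2\<close> whose
  data are the squares of the coordinates of \<open>y\<close> in an eigenbasis. All these coordinates are nonzero for almost
  every \<open>y\<close>; this rules out solutions with \<open>\<sigma>\<^sub>1\<^sup>2 \<lambda>\<^sub>i + \<sigma>\<^sub>2\<^sup>2 = 0\<close>, so that the variance components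
  determine \<open>\<beta>\<close>. The equations are homogeneous enough that \<open>\<sigma>\<^sub>2\<^sup>2\<close> is determined by
  \<open>x = \<sigma>\<^sub>1\<^sup>2 / \<sigma>\<^sub>2\<^sup>2\<close>, and \<open>x\<close> is a root of a polynomial of degree at most \<open>2 r + a - 1\<close>, where \<open>r\<close> and \<open>a\<close> are
  the numbers of nonzero \<open>\<lambda>\<^sub>i\<close> and \<open>\<mu>\<^sub>j\<close>; it does not vanish because some \<open>\<lambda>\<^sub>i\<close> is zero, by the
  hypothesis on column spaces. Here \<open>a \<le> q\<close>, and \<open>r \<le> q - 1\<close> because \<open>Z\<close> maps the all-ones vector into the
  column space of \<open>X\<close>. In the centered model both spectra agree and the degree drops to \<open>2 r - 1\<close>.\<close>

text \<open>The projection \<open>M\<close> and \<open>V\<close> need not commute, so no basis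
  diagonalizes both sides of the equations: the traces see the spectrum of \<open>V\<close>, the
  quadratic forms that of \<open>M * V * M\<close>. The two are tied together by w =
  \<open>S *\<^sub>v r\<close>, the residual multiplied by the inverse covariance. The equation for
  \<beta> puts w into the range of \<open>M\<close>, the quadratic forms become w'Vw and w'w, and
  projecting the identity "covariance times w equals y - X \<beta>" onto that range removes \<beta>
  and leaves one scalar equation per eigenvector.

  The eliminant is a difference of two products: one has degree exactly 2 r + a - 1, the other is
  zero or of degree at most 2 r + a - 2. The leading coefficient of the first contains the sum of
  the squared data coordinates that belong to zero eigenvalues \<lambda>. Squares of nonzero reals
  cannot cancel, so this sum is nonzero for generic data.\<close>

section \<open>Orthogonal diagonalization of real symmetric matrices\<close>

no_notation inner (infix "\<bullet>" 70)
no_notation Finite_Cartesian_Product.vec_nth (infixl "$" 90)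

lemma symmetric_bilinear:
  fixes A :: "'a :: comm_semiring_0 mat"
  assumes A: "A \<in> carrier_mat n n" and s: "transpose_mat A = A"
    and u: "u \<in> carrier_vec n" and v: "v \<in> carrier_vec n"
  shows "u \<bullet> (A *\<^sub>v v) = (A *\<^sub>v u) \<bullet> v"
  using transpose_vec_mult_scalar[OF A v u] s by metis

lemma scalar_prod_self_nonneg: "(v :: real Matrix.vec) \<bullet> v \<ge> 0"
  by (simp add: scalar_prod_def sum_nonneg)

lemma scalar_prod_self_eq_0:
  fixes v :: "real Matrix.vec"
  assumes "v \<in> carrier_vec n"
  shows "v \<bullet> v = 0 \<longleftrightarrow> v = 0\<^sub>v n"
  using conjugate_square_eq_0_vec[OF assms] by simp

text \<open>A complex eigenpair exists, and evaluating
  \<open>conjugate v \<bullet> (C *\<^sub>v v)\<close> in two ways gives \<open>k = cnj k\<close>.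
  Since \<open>A\<close> and \<open>k\<close> are real, the real and the imaginary part of
  \<open>v\<close> each satisfy the eigenvector equation, and one of them is nonzero.\<close>

lemma symmetric_real_eigenvector:
  fixes A :: "real mat"
  assumes A: "A \<in> carrier_mat n n" and s: "transpose_mat A = A" and n: "n > 0"
  obtains k v where "v \<in> carrier_vec n" "v \<noteq> 0\<^sub>v n" "A *\<^sub>v v = k \<cdot>\<^sub>v v"
proof -
  define C where "C = map_mat complex_of_real A"
  have C: "C \<in> carrier_mat n n" using A by (simp add: C_def)
  obtain k where "k \<in> spectrum C" using spectrum_non_empty[OF C n] by auto
  then obtain v where v: "v \<in> carrier_vec n" "v \<noteq> 0\<^sub>v n" "C *\<^sub>v v = k \<cdot>\<^sub>v v"
    using C unfolding spectrum_def eigenvalue_def eigenvector_def by auto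
  have Cs: "transpose_mat C = C" using s unfolding C_def by (metis map_mat_transpose)
  have cj: "C *\<^sub>v conjugate v = conjugate (C *\<^sub>v v)"
    using C v(1) A by (intro eq_vecI) (auto simp: C_def scalar_prod_def)
  have "k * (conjugate v \<bullet> v) = conjugate v \<bullet> (C *\<^sub>v v)"
    unfolding v(3) using v(1) by simp
  also have "\<dots> = (C *\<^sub>v conjugate v) \<bullet> v"
    using symmetric_bilinear[OF C Cs _ v(1), of "conjugate v"] v(1) by simp
  also have "\<dots> = conjugate k * (conjugate v \<bullet> v)"
    unfolding cj v(3) using v(1) by (simp add: conjugate_smult_vec)
  finally have e: "k * (conjugate v \<bullet> v) = conjugate k * (conjugate v \<bullet> v)" .
  have "conjugate v \<bullet> v \<noteq> 0"
    using conjugate_square_eq_0_vec[OF v(1)] v(1,2) by (metis conjugate_vec_sprod_comm)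
  with e have "k = cnj k" by simp
  then have kr: "k = complex_of_real (Re k)" by (simp add: complex_eq_iff)
  have main: "A *\<^sub>v map_vec f v = Re k \<cdot>\<^sub>v map_vec f v"
    if "f = Re \<or> f = Im" for f
  proof (rule eq_vecI)
    fix i assume "i < dim_vec (Re k \<cdot>\<^sub>v map_vec f v)"
    then have i: "i < n" using v by simp
    have "(C *\<^sub>v v) $ i = (k \<cdot>\<^sub>v v) $ i" using v by simp
    then have "(\<Sum>j<n. complex_of_real (A $$ (i,j)) * v $ j) = complex_of_real (Re k) * v $ i"
      using i v(1) A kr by (simp add: C_def scalar_prod_def atLeast0LessThan)
    from arg_cong[OF this, of f]
    show "(A *\<^sub>v map_vec f v) $ i = (Re k \<cdot>\<^sub>v map_vec f v) $ i"
      using i v(1) A that by (auto simp: scalar_prod_def atLeast0LessThan)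
  qed (use A v in auto)
  have "map_vec Re v \<noteq> 0\<^sub>v n \<or> map_vec Im v \<noteq> 0\<^sub>v n"
  proof (rule ccontr)
    assume "\<not> ?thesis"
    then have "Re (v $ i) = 0 \<and> Im (v $ i) = 0" if "i < n" for i
      using that v(1) by (metis carrier_vecD index_map_vec(1) index_zero_vec(1))
    then have "v = 0\<^sub>v n" using v(1) by (intro eq_vecI) (auto simp: complex_eq_iff)
    with v(2) show False by simp
  qed
  with main v(1) that show thesis by (metis map_carrier_vec)
qed

text \<open>Gram-Schmidt keeps the first vector of a basis that starts with \<open>v\<close>;
  dividing by the lengths afterwards turns the orthogonal family into an orthonormal one. The scalar
  \<open>c\<close> in the conclusion is harmless because \<open>v\<close> will be an
  eigenvector.\<close>

lemma orthonormal_completion: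
  fixes v :: "real Matrix.vec"
  assumes v: "v \<in> carrier_vec n" "v \<noteq> 0\<^sub>v n"
  obtains W c where "W \<in> carrier_mat n n" "transpose_mat W * W = 1\<^sub>m n" "col W 0 = c \<cdot>\<^sub>v v"
proof -
  interpret cof_vec_space n "TYPE(real)" .
  define b where "b = basis_completion v"
  note b = basis_completion[OF v, folded b_def]
  define ws where "ws = gram_schmidt n b"
  note ws = gram_schmidt_result[OF b(2,4,5) ws_def]
  have n: "n > 0" using v by (metis gr0I carrier_vecD vec_of_dim_0 zero_carrier_vec)
  have hd: "ws ! 0 = v"
  proof -
    obtain bs where "b = v # bs" using b(6,7) n by (cases b) auto
    then have "hd ws = v" unfolding ws_def using v by simp
    then show ?thesis using ws(4) b(6) n by (metis hd_conv_nth length_0_conv less_irrefl)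
  qed
  have len: "length ws = n" using ws(4) b(6) by simp
  have car: "ws ! i \<in> carrier_vec n" if "i < n" for i using ws(3) len that by auto
  have orth: "ws ! i \<bullet> ws ! j = 0 \<longleftrightarrow> i \<noteq> j" if "i < n" "j < n" for i j
    using corthogonalD[OF ws(2)] len that by simp
  have pos: "ws ! i \<bullet> ws ! i > 0" if "i < n" for i
    using orth[of i i] that scalar_prod_self_nonneg[of "ws ! i"] by (simp add: less_le)
  define c where "c = (\<lambda>i. 1 / sqrt (ws ! i \<bullet> ws ! i))"
  define W where "W = mat_of_cols n (map (\<lambda>i. c i \<cdot>\<^sub>v ws ! i) [0..<n])"
  have W: "W \<in> carrier_mat n n" by (rule carrier_matI) (auto simp: W_def)
  have colW: "col W i = c i \<cdot>\<^sub>v ws ! i" if "i < n" for i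
    using that car[OF that] unfolding W_def by (subst col_mat_of_cols) auto
  have "transpose_mat W * W = 1\<^sub>m n"
  proof (rule eq_matI)
    fix i j assume "i < dim_row (1\<^sub>m n :: real mat)" "j < dim_col (1\<^sub>m n :: real mat)"
    then have ij: "i < n" "j < n" by auto
    have "(transpose_mat W * W) $$ (i,j) = c i * c j * (ws ! i \<bullet> ws ! j)"
      using ij W car colW
      by (simp add: smult_scalar_prod_distrib[of _ n] scalar_prod_smult_distrib[of _ n])
    also have "\<dots> = (if i = j then 1 else 0)"
      using orth[OF ij] pos[OF ij(1)] ij by (auto simp: c_def)
    finally show "(transpose_mat W * W) $$ (i,j) = 1\<^sub>m n $$ (i,j)" using ij by simp
  qed (use W in auto)
  moreover have "col W 0 = c 0 \<cdot>\<^sub>v v" using colW[OF n] hd by simp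
  ultimately show thesis using that W by blast
qed

text \<open>Deflation: in an orthonormal basis whose first vector is an eigenvector, symmetry clears
  the first row along with the first column, and the remaining block is again symmetric and one size
  smaller.\<close>

theorem symmetric_diagonalization:
  fixes A :: "real mat"
  assumes "A \<in> carrier_mat n n" "transpose_mat A = A"
  obtains Q l where "Q \<in> carrier_mat n n" "transpose_mat Q * Q = 1\<^sub>m n" "Q * transpose_mat Q = 1\<^sub>m n"
    "transpose_mat Q * A * Q = Matrix.mat n n (\<lambda>(i,j). if i = j then l i else 0)"
proof -
  have "\<exists>Q l. Q \<in> carrier_mat n n \<and> transpose_mat Q * Q = 1\<^sub>m n \<and>
    transpose_mat Q * A * Q = Matrix.mat n n (\<lambda>(i,j). if i = j then l i else 0)"
    using assms
  proof (induction n arbitrary: A)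
    case 0
    show ?case by (rule exI[of _ "1\<^sub>m 0"], rule exI[of _ "\<lambda>_. 0"]) (use 0 in auto)
  next
    case (Suc n A)
    note A = Suc.prems(1)
    obtain k v where v: "v \<in> carrier_vec (Suc n)" "v \<noteq> 0\<^sub>v (Suc n)" "A *\<^sub>v v = k \<cdot>\<^sub>v v"
      using symmetric_real_eigenvector[OF Suc.prems] by blast
    obtain W c where W: "W \<in> carrier_mat (Suc n) (Suc n)" "transpose_mat W * W = 1\<^sub>m (Suc n)"
      and W0: "col W 0 = c \<cdot>\<^sub>v v"
      using orthonormal_completion[OF v(1,2)] by blast
    define C where "C = transpose_mat W * A * W"
    have C: "C \<in> carrier_mat (Suc n) (Suc n)" using W A by (simp add: C_def)
    have Cs: "transpose_mat C = C"
    proof -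
      have "transpose_mat C = transpose_mat W * transpose_mat (transpose_mat W * A)"
        unfolding C_def using W A by (subst transpose_mult) auto
      also have "\<dots> = transpose_mat W * (transpose_mat A * W)"
        using W A by (subst transpose_mult) auto
      finally show ?thesis unfolding C_def Suc.prems(2) using W A
        by (metis assoc_mult_mat transpose_carrier_mat)
    qed
    have Aw: "A *\<^sub>v col W 0 = k \<cdot>\<^sub>v col W 0"
      unfolding W0 using A v by (simp add: mult_mat_vec smult_smult_assoc mult.commute)
    have C0: "C $$ (i, 0) = (if i = 0 then k else 0)" if i: "i < Suc n" for i
    proof -
      have "C $$ (i, 0) = col W i \<bullet> (A *\<^sub>v col W 0)"
        using i W(1) A unfolding C_def by (subst assoc_mult_mat) (auto simp: col_mult2 mult_mat_vec_def)
      also have "\<dots> = k * (transpose_mat W * W) $$ (i, 0)"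
        unfolding Aw using i W(1) by simp
      finally show ?thesis using i unfolding W(2) by simp
    qed
    have C0': "C $$ (0, i) = (if i = 0 then k else 0)" if i: "i < Suc n" for i
      using C0[OF i] Cs C i by (metis carrier_matD index_transpose_mat(1) zero_less_Suc)
    define C' where "C' = Matrix.mat n n (\<lambda>(i,j). C $$ (Suc i, Suc j))"
    have C': "C' \<in> carrier_mat n n" by (simp add: C'_def)
    have "transpose_mat C' = C'"
    proof (rule eq_matI)
      fix i j assume "i < dim_row C'" "j < dim_col C'"
      then show "transpose_mat C' $$ (i,j) = C' $$ (i,j)"
        using C Cs index_transpose_mat(1)[of "Suc i" C "Suc j"] by (simp add: C'_def)
    qed (auto simp: C'_def)
    from Suc.IH[OF C' this] obtain R l where R: "R \<in> carrier_mat n n"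
      "transpose_mat R * R = 1\<^sub>m n"
      "transpose_mat R * C' * R = Matrix.mat n n (\<lambda>(i,j). if i = j then l i else 0)" by blast
    define K where "K = Matrix.mat 1 1 (\<lambda>_. k)"
    have K: "K \<in> carrier_mat 1 1" by (simp add: K_def)
    \<comment> \<open>The diagonalizer of the smaller block, bordered by a 1 so that it leaves the
      eigenvector already found in place.\<close>
    define T where "T = four_block_mat (1\<^sub>m 1) (0\<^sub>m 1 n) (0\<^sub>m n 1) R"
    have T: "T \<in> carrier_mat (Suc n) (Suc n)"
      using four_block_carrier_mat[of "1\<^sub>m 1" 1 1 R n n "0\<^sub>m 1 n" "0\<^sub>m n 1"] R(1) by (simp add: T_def)
    have Tt: "transpose_mat T = four_block_mat (1\<^sub>m 1) (0\<^sub>m 1 n) (0\<^sub>m n 1) (transpose_mat R)"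
      unfolding T_def using R(1) by (subst transpose_four_block_mat) auto
    have Cb: "C = four_block_mat K (0\<^sub>m 1 n) (0\<^sub>m n 1) C'"
      by (rule eq_matI) (use C C0 C0' C' K in \<open>auto simp: K_def C'_def\<close>)
    have TT: "transpose_mat T * T = 1\<^sub>m (Suc n)"
    proof -
      have "transpose_mat T * T = four_block_mat (1\<^sub>m 1) (0\<^sub>m 1 n) (0\<^sub>m n 1) (1\<^sub>m n)"
        unfolding Tt unfolding T_def using R
        by (subst mult_four_block_mat[of _ 1 1 _ n _ n _ _ 1 _ n]) auto
      also have "\<dots> = 1\<^sub>m (Suc n)" by (rule eq_matI) auto
      finally show ?thesis .
    qed
    have TCT: "transpose_mat T * C * T = four_block_mat K (0\<^sub>m 1 n) (0\<^sub>m n 1) (transpose_mat R * C' * R)"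
    proof -
      have 1: "transpose_mat T * C = four_block_mat K (0\<^sub>m 1 n) (0\<^sub>m n 1) (transpose_mat R * C')"
        unfolding Tt Cb using R(1) C' K
        by (subst mult_four_block_mat[of _ 1 1 _ n _ n _ _ 1 _ n]) auto
      show ?thesis unfolding 1 unfolding T_def using R(1) C' K
        by (subst mult_four_block_mat[of _ 1 1 _ n _ n _ _ 1 _ n]) auto
    qed
    define Q where "Q = W * T"
    have Qt: "transpose_mat Q = transpose_mat T * transpose_mat W"
      unfolding Q_def using W T by (subst transpose_mult) auto
    have "transpose_mat Q * Q = transpose_mat T * (transpose_mat W * W) * T"
      unfolding Qt unfolding Q_def using W(1) T
      by (smt (verit) assoc_mult_mat mult_carrier_mat transpose_carrier_mat)
    then have q1: "transpose_mat Q * Q = 1\<^sub>m (Suc n)" unfolding W(2) using T TT by simp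
    have "transpose_mat Q * A * Q = transpose_mat T * C * T"
      unfolding Qt C_def unfolding Q_def using W(1) T A
      by (smt (verit) assoc_mult_mat mult_carrier_mat transpose_carrier_mat)
    also have "\<dots> = Matrix.mat (Suc n) (Suc n) (\<lambda>(i,j). if i = j then case_nat k l i else 0)"
      unfolding TCT R(3) by (rule eq_matI) (auto simp: K_def split: nat.splits)
    finally have q2: "transpose_mat Q * A * Q = \<dots>" .
    show ?case
      by (rule exI[of _ Q], rule exI[of _ "case_nat k l"]) (use q1 q2 W(1) T in \<open>auto simp: Q_def\<close>)
  qed
  then obtain Q l where Q: "Q \<in> carrier_mat n n" "transpose_mat Q * Q = 1\<^sub>m n"
    "transpose_mat Q * A * Q = Matrix.mat n n (\<lambda>(i,j). if i = j then l i else 0)" by blast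
  moreover have "Q * transpose_mat Q = 1\<^sub>m n"
    using mat_mult_left_right_inverse[OF _ Q(1,2)] Q(1) by simp
  ultimately show thesis using that by blast
qed

section \<open>Hyperplanes are Lebesgue null sets\<close>

lemma AE_lborel_affine_nonzero:
  fixes c d :: real assumes "c \<noteq> 0"
  shows "AE x in lborel. c * x + d \<noteq> 0"
proof -
  have "{x. c * x + d = 0} \<subseteq> {- d / c}" using assms by (auto simp: field_simps add_eq_0_iff)
  then have "{x. c * x + d = 0} \<in> null_sets lborel"
    by (metis finite_imp_null_set_lborel finite.emptyI finite.insertI finite_subset)
  then have "AE x in lborel. x \<notin> {x. c * x + d = 0}" by (rule AE_not_in)
  then show ?thesis by simp
qed

text \<open>Fubini in the coordinate \<open>k\<close>: with all other coordinates fixed, the sum is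
  an affine function with nonzero slope \<open>c k\<close> and vanishes at a single point, so every
  section of the hyperplane is null.\<close>

lemma AE_PiM_linear_nonzero:
  fixes c :: "'i \<Rightarrow> real"
  assumes I: "finite I" and k: "k \<in> I" "c k \<noteq> 0"
  shows "AE y in Pi\<^sub>M I (\<lambda>_. lborel). (\<Sum>i\<in>I. c i * y i) \<noteq> 0"
proof -
  interpret product_sigma_finite "\<lambda>_ :: 'i. lborel :: real measure"
    by (simp add: product_sigma_finite_def sigma_finite_lborel)
  define J where "J = I - {k}"
  have J: "finite J" "k \<notin> J" "I = insert k J" using I k by (auto simp: J_def)
  define A where "A = {y \<in> space (Pi\<^sub>M I (\<lambda>_. lborel)). (\<Sum>i\<in>I. c i * y i) = 0}"
  have A: "A \<in> sets (Pi\<^sub>M I (\<lambda>_. lborel))" unfolding A_def by measurable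
  have "emeasure (Pi\<^sub>M I (\<lambda>_. lborel)) A = (\<integral>\<^sup>+ y. indicator A y \<partial>Pi\<^sub>M (insert k J) (\<lambda>_. lborel))"
    using A J(3) by simp
  also have "\<dots> = (\<integral>\<^sup>+ x. (\<integral>\<^sup>+ t. indicator A (x(k := t)) \<partial>lborel) \<partial>Pi\<^sub>M J (\<lambda>_. lborel))"
    by (rule product_nn_integral_insert) (use A J in auto)
  also have "\<dots> = (\<integral>\<^sup>+ x. 0 \<partial>Pi\<^sub>M J (\<lambda>_. lborel :: real measure))"
  proof (rule nn_integral_cong)
    fix x :: "'i \<Rightarrow> real"
    have "AE t in lborel. indicator A (x(k := t)) = (0 :: ennreal)"
      using AE_lborel_affine_nonzero[OF k(2), of "\<Sum>i\<in>J. c i * x i"]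
    proof eventually_elim
      case (elim t)
      have "(\<Sum>i\<in>I. c i * (x(k := t)) i) = c k * t + (\<Sum>i\<in>J. c i * x i)"
        unfolding J(3) using J(1,2) by (auto intro!: sum.cong)
      with elim show ?case by (auto simp: A_def)
    qed
    then have "(\<integral>\<^sup>+ t. indicator A (x(k := t)) \<partial>lborel) = (\<integral>\<^sup>+ t. 0 \<partial>(lborel :: real measure))"
      by (rule nn_integral_cong_AE)
    then show "(\<integral>\<^sup>+ t. indicator A (x(k := t)) \<partial>lborel) = 0" by simp
  qed
  finally have "A \<in> null_sets (Pi\<^sub>M I (\<lambda>_. lborel))" using A by auto
  then have "AE y in Pi\<^sub>M I (\<lambda>_. lborel). y \<notin> A" by (rule AE_not_in)
  then show ?thesis using AE_space by eventually_elim (auto simp: A_def)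
qed

text \<open>Applied with \<open>C\<close> the columns of an eigenbasis, this is the only genericity
  of the data that the degree bounds use.\<close>

lemma AE_scalar_prod_nonzero:
  assumes "finite C" "C \<subseteq> carrier_vec n" "0\<^sub>v n \<notin> C"
  shows "AE y in Pi\<^sub>M {..<n} (\<lambda>_. lborel). \<forall>c\<in>C. c \<bullet> Matrix.vec n y \<noteq> (0 :: real)"
proof (rule AE_finite_allI[OF assms(1)])
  fix c assume c: "c \<in> C"
  then have cn: "c \<in> carrier_vec n" "c \<noteq> 0\<^sub>v n" using assms by auto
  then obtain k where "k < n" "c $ k \<noteq> 0"
    by (metis carrier_vecD eq_vecI index_zero_vec)
  then have "AE y in Pi\<^sub>M {..<n} (\<lambda>_. lborel). (\<Sum>i\<in>{..<n}. c $ i * y i) \<noteq> 0"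
    by (intro AE_PiM_linear_nonzero) auto
  then show "AE y in Pi\<^sub>M {..<n} (\<lambda>_. lborel). c \<bullet> Matrix.vec n y \<noteq> 0"
    by (simp add: scalar_prod_def atLeast0LessThan)
qed

section \<open>Counting solutions of the diagonalized likelihood equations\<close>

text \<open>Two spectra are kept apart: \<open>m\<close> on \<open>J\<close> enters through the
  traces, \<open>l\<close> on \<open>I\<close> through the quadratic forms, with \<open>t\<close>
  the squared coordinates of the data. The index sets may differ in size, because the compression of
  \<open>V\<close> lives on the residual space only.\<close>

definition likelihood_solutions ::
  "'i set \<Rightarrow> ('i \<Rightarrow> complex) \<Rightarrow> ('i \<Rightarrow> complex) \<Rightarrow> 'j set \<Rightarrow> ('j \<Rightarrow> complex) \<Rightarrow> (complex \<times> complex) set" where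
  "likelihood_solutions I l t J m =
     {(a, b). (\<forall>i\<in>I. a * l i + b \<noteq> 0) \<and> (\<forall>j\<in>J. a * m j + b \<noteq> 0) \<and>
        (\<Sum>j\<in>J. m j / (a * m j + b)) = (\<Sum>i\<in>I. l i * t i / (a * l i + b)\<^sup>2) \<and>
        (\<Sum>j\<in>J. 1 / (a * m j + b)) = (\<Sum>i\<in>I. t i / (a * l i + b)\<^sup>2)}"

text \<open>Up to a power of b, the determinant of a covariance with eigenvalues
  \<open>a * l i + b\<close>, written in the ratio x = a / b. Zero eigenvalues contribute constant
  factors, so its degree counts the nonzero ones.\<close>

definition affine_prod :: "'i set \<Rightarrow> ('i \<Rightarrow> complex) \<Rightarrow> complex poly" where
  "affine_prod A l = (\<Prod>i\<in>A. [:1, l i:])"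

lemma poly_affine_prod: "poly (affine_prod A l) x = (\<Prod>i\<in>A. 1 + x * l i)"
  by (simp add: affine_prod_def poly_prod)

lemma affine_prod_nonzero: "affine_prod A l \<noteq> 0"
proof (cases "finite A")
  case True
  then show ?thesis by (auto simp: affine_prod_def)
qed (simp add: affine_prod_def)

lemma degree_affine_prod:
  assumes "finite A" "\<And>i. i \<in> A \<Longrightarrow> l i \<noteq> 0"
  shows "degree (affine_prod A l) = card A"
proof -
  have "degree (affine_prod A l) = (\<Sum>i\<in>A. degree [:1, l i:])"
    unfolding affine_prod_def using assms(1) by (intro degree_prod_eq_sum_degree) auto
  also have "\<dots> = card A" using assms by simp
  finally show ?thesis .
qed

lemma poly_affine_prod_remove:
  assumes "finite A" "i \<in> A" "1 + x * l i \<noteq> 0"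
  shows "poly (affine_prod (A - {i}) l) x = poly (affine_prod A l) x / (1 + x * l i)"
  using assms by (simp add: poly_affine_prod prod.remove[of A i])

text \<open>Logarithmic derivative: the trace term is D'/D for D = \<open>affine_prod A l\<close>.
  Writing it this way makes the degree and the leading coefficient of its numerator
  immediate.\<close>

lemma poly_pderiv_affine_prod:
  assumes "finite A" "\<And>i. i \<in> A \<Longrightarrow> 1 + x * l i \<noteq> 0"
  shows "poly (pderiv (affine_prod A l)) x = poly (affine_prod A l) x * (\<Sum>i\<in>A. l i / (1 + x * l i))"
proof -
  have "poly (pderiv (affine_prod A l)) x = (\<Sum>i\<in>A. poly (affine_prod (A - {i}) l) x * l i)"
    unfolding affine_prod_def by (simp add: pderiv_prod pderiv_pCons poly_sum mult.commute)
  also have "\<dots> = (\<Sum>i\<in>A. poly (affine_prod A l) x * (l i / (1 + x * l i)))"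
    using assms by (intro sum.cong) (simp_all add: poly_affine_prod_remove)
  finally show ?thesis by (simp add: sum_distrib_left)
qed

text \<open>Numerator of t0 + \<Sum> t_i / (1 + x l_i) over the common denominator
  \<open>affine_prod A l\<close>. The data of the zero eigenvalues have denominator 1 and are
  collected in \<open>t0\<close>.\<close>

definition quad_poly :: "complex \<Rightarrow> 'i set \<Rightarrow> ('i \<Rightarrow> complex) \<Rightarrow> ('i \<Rightarrow> complex) \<Rightarrow> complex poly" where
  "quad_poly t0 A l t = Polynomial.smult t0 (affine_prod A l) + (\<Sum>i\<in>A. Polynomial.smult (t i) (affine_prod (A - {i}) l))"

text \<open>Numerator of \<Sum> l_i t_i / (1 + x l_i)^2 over the square of
  \<open>affine_prod A l\<close>. Zero eigenvalues drop out because of the factor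
  \<open>l i\<close>.\<close>

definition quad_sq_poly :: "'i set \<Rightarrow> ('i \<Rightarrow> complex) \<Rightarrow> ('i \<Rightarrow> complex) \<Rightarrow> complex poly" where
  "quad_sq_poly A l t = (\<Sum>i\<in>A. Polynomial.smult (l i * t i) ((affine_prod (A - {i}) l)\<^sup>2))"

lemma poly_quad_poly:
  assumes "finite A" "\<And>i. i \<in> A \<Longrightarrow> 1 + x * l i \<noteq> 0"
  shows "poly (quad_poly t0 A l t) x =
    poly (affine_prod A l) x * (t0 + (\<Sum>i\<in>A. t i / (1 + x * l i)))"
proof -
  have "(\<Sum>i\<in>A. t i * poly (affine_prod (A - {i}) l) x) = (\<Sum>i\<in>A. poly (affine_prod A l) x * (t i / (1 + x * l i)))"
    using assms by (intro sum.cong) (simp_all add: poly_affine_prod_remove)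
  then show ?thesis by (simp add: quad_poly_def poly_sum sum_distrib_left distrib_left)
qed

lemma poly_quad_sq_poly:
  assumes "finite A" "\<And>i. i \<in> A \<Longrightarrow> 1 + x * l i \<noteq> 0"
  shows "poly (quad_sq_poly A l t) x =
    (poly (affine_prod A l) x)\<^sup>2 * (\<Sum>i\<in>A. l i * t i / (1 + x * l i)\<^sup>2)"
proof -
  have "(\<Sum>i\<in>A. l i * t i * (poly (affine_prod (A - {i}) l) x)\<^sup>2)
      = (\<Sum>i\<in>A. (poly (affine_prod A l) x)\<^sup>2 * (l i * t i / (1 + x * l i)\<^sup>2))"
    using assms by (intro sum.cong) (simp_all add: poly_affine_prod_remove power_divide)
  then show ?thesis by (simp add: quad_sq_poly_def poly_sum sum_distrib_left)
qed

text \<open>Only the \<open>t0\<close> term reaches degree \<open>card A\<close>, since every other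
  summand lacks one factor. The condition \<open>t0 \<noteq> 0\<close> is where a zero eigenvalue
  with generic data becomes indispensable.\<close>

lemma degree_quad_poly:
  assumes "finite A" "\<And>i. i \<in> A \<Longrightarrow> l i \<noteq> 0" "t0 \<noteq> 0"
  shows "degree (quad_poly t0 A l t) = card A" "quad_poly t0 A l t \<noteq> 0"
proof -
  have "degree (quad_poly t0 A l t) = card A \<and> quad_poly t0 A l t \<noteq> 0"
  proof (cases "A = {}")
    case True
    then show ?thesis using assms(3) by (simp add: quad_poly_def affine_prod_def)
  next
    case False
    then have pos: "card A > 0" using assms(1) by (simp add: card_gt_0_iff)
    have "degree (\<Sum>i\<in>A. Polynomial.smult (t i) (affine_prod (A - {i}) l)) \<le> card A - 1"
    proof (rule degree_sum_le[OF assms(1)])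
      fix i assume i: "i \<in> A"
      have "degree (affine_prod (A - {i}) l) = card A - 1"
        using assms(1,2) i by (subst degree_affine_prod) auto
      then show "degree (Polynomial.smult (t i) (affine_prod (A - {i}) l)) \<le> card A - 1"
        by (metis degree_smult_le)
    qed
    also have "\<dots> < degree (Polynomial.smult t0 (affine_prod A l))"
      using pos assms by (simp add: degree_affine_prod)
    finally have "degree (quad_poly t0 A l t) = card A"
      unfolding quad_poly_def using assms by (subst degree_add_eq_left) (simp_all add: degree_affine_prod)
    with pos show ?thesis by auto
  qed
  then show "degree (quad_poly t0 A l t) = card A" "quad_poly t0 A l t \<noteq> 0" by auto
qed

text \<open>Each summand lacks the same factor in both copies of the product, so the degree is two
  below that of the full square. For empty \<open>A\<close> the sum is zero and the truncated
  difference does no harm.\<close>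

lemma degree_quad_sq_poly:
  assumes "finite A" "\<And>i. i \<in> A \<Longrightarrow> l i \<noteq> 0"
  shows "degree (quad_sq_poly A l t) \<le> 2 * (card A - 1)"
  unfolding quad_sq_poly_def
proof (rule degree_sum_le[OF assms(1)])
  fix i assume i: "i \<in> A"
  have "degree (affine_prod (A - {i}) l) = card A - 1"
    using assms i by (subst degree_affine_prod) auto
  then have "degree ((affine_prod (A - {i}) l)\<^sup>2) = 2 * (card A - 1)"
    by (simp add: degree_power_eq affine_prod_nonzero)
  then show "degree (Polynomial.smult (l i * t i) ((affine_prod (A - {i}) l)\<^sup>2)) \<le> 2 * (card A - 1)"
    by (metis degree_smult_le)
qed

text \<open>The alternative \<open>q = 0\<close> covers a constant \<open>p\<close>, where no degree
  is strictly smaller. It occurs when all \<lambda> vanish and \<open>V\<close> has a single nonzero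
  eigenvalue.\<close>

lemma degree_diff_dominant:
  fixes p q :: "'a :: ab_group_add poly"
  assumes "p \<noteq> 0" "q = 0 \<or> degree q < degree p"
  shows "p - q \<noteq> 0" "degree (p - q) = degree p"
proof -
  show d: "degree (p - q) = degree p"
    using assms(2) degree_add_eq_left[of "-q" p] by auto
  show "p - q \<noteq> 0"
    using assms d by auto
qed

text \<open>Weighting the two likelihood equations with the variance components shows that the error
  variance is determined by the ratio of the components, so that it suffices to count ratios.\<close>

lemma likelihood_solutions_ratio:
  assumes fin: "finite I" "finite J" and J: "J \<noteq> {}"
    and i0: "i0 \<in> I" "l i0 = 0"
    and s: "(a, b) \<in> likelihood_solutions I l t J m"
  defines "x \<equiv> a / b"
  defines "A \<equiv> {i\<in>I. l i \<noteq> 0}" and "t0 \<equiv> (\<Sum>i | i \<in> I \<and> l i = 0. t i)"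
  shows "b \<noteq> 0"
    and "\<And>i. i \<in> I \<Longrightarrow> 1 + x * l i \<noteq> 0" and "\<And>j. j \<in> J \<Longrightarrow> 1 + x * m j \<noteq> 0"
    and "of_nat (card J) * b = t0 + (\<Sum>i\<in>A. t i / (1 + x * l i))"
    and "b * (\<Sum>j\<in>J. m j / (1 + x * m j)) = (\<Sum>i\<in>A. l i * t i / (1 + x * l i)\<^sup>2)"
proof -
  have nz: "\<And>i. i \<in> I \<Longrightarrow> a * l i + b \<noteq> 0" "\<And>j. j \<in> J \<Longrightarrow> a * m j + b \<noteq> 0"
    and e1: "(\<Sum>j\<in>J. m j / (a * m j + b)) = (\<Sum>i\<in>I. l i * t i / (a * l i + b)\<^sup>2)"
    and e2: "(\<Sum>j\<in>J. 1 / (a * m j + b)) = (\<Sum>i\<in>I. t i / (a * l i + b)\<^sup>2)"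
    using s by (auto simp: likelihood_solutions_def)
  show b: "b \<noteq> 0" using nz(1)[OF i0(1)] i0(2) by simp
  have f: "a * c + b = b * (1 + x * c)" for c using b by (simp add: x_def field_simps)
  show nzl: "1 + x * l i \<noteq> 0" if "i \<in> I" for i using nz(1)[OF that] f[of "l i"] by auto
  show nzm: "1 + x * m j \<noteq> 0" if "j \<in> J" for j using nz(2)[OF that] f[of "m j"] by auto
  have split: "(\<Sum>i\<in>I. h i) = (\<Sum>i | i \<in> I \<and> l i = 0. h i) + (\<Sum>i\<in>A. h i)" for h :: "_ \<Rightarrow> complex"
    using fin(1) by (subst sum.union_disjoint[symmetric]) (auto simp: A_def intro!: sum.cong)
  \<comment> \<open>Every summand is (a m_j + b) / (a m_j + b) = 1. On the other side the same
    weights lower the squared denominators to first powers.\<close>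
  have "of_nat (card J) = (\<Sum>j\<in>J. a * (m j / (a * m j + b)) + b * (1 / (a * m j + b)))"
    using nz(2) by (simp add: add_divide_distrib[symmetric] del: times_divide_eq_right add: times_divide_eq_right)
  also have "\<dots> = a * (\<Sum>i\<in>I. l i * t i / (a * l i + b)\<^sup>2) + b * (\<Sum>i\<in>I. t i / (a * l i + b)\<^sup>2)"
    unfolding sum.distrib sum_distrib_left[symmetric] e1 e2 ..
  also have "\<dots> = (\<Sum>i\<in>I. t i / (a * l i + b))"
    unfolding sum_distrib_left sum.distrib[symmetric]
  proof (rule sum.cong)
    fix i assume "i \<in> I"
    then have "a * l i + b \<noteq> 0" using nz(1) by simp
    moreover have "a * (l i * t i / y\<^sup>2) + b * (t i / y\<^sup>2) = (a * l i + b) * t i / y\<^sup>2" for y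
      by (simp add: add_divide_distrib distrib_right)
    ultimately show "a * (l i * t i / (a * l i + b)\<^sup>2) + b * (t i / (a * l i + b)\<^sup>2) = t i / (a * l i + b)"
      by (simp add: power2_eq_square)
  qed simp
  finally have "of_nat (card J) * b = (\<Sum>i\<in>I. t i / (1 + x * l i))"
    using b by (simp add: f sum_distrib_right)
  then show "of_nat (card J) * b = t0 + (\<Sum>i\<in>A. t i / (1 + x * l i))"
    by (simp add: split t0_def)
  have "b * (\<Sum>j\<in>J. m j / (1 + x * m j)) = b\<^sup>2 * (\<Sum>j\<in>J. m j / (a * m j + b))"
    unfolding f using b by (simp add: sum_distrib_left power2_eq_square)
  also have "\<dots> = b\<^sup>2 * (\<Sum>i\<in>I. l i * t i / (b * (1 + x * l i))\<^sup>2)"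
    using e1 by (simp only: f)
  also have "\<dots> = (\<Sum>i\<in>I. l i * t i / (1 + x * l i)\<^sup>2)"
    using b by (simp add: sum_distrib_left power_mult_distrib)
  also have "\<dots> = (\<Sum>i\<in>A. l i * t i / (1 + x * l i)\<^sup>2)" by (simp add: split)
  finally show "b * (\<Sum>j\<in>J. m j / (1 + x * m j)) = (\<Sum>i\<in>A. l i * t i / (1 + x * l i)\<^sup>2)" .
qed

text \<open>The identity for \<open>of_nat (card J) * b\<close> expresses \<open>b\<close> through
  the ratio, so \<open>a / b\<close> determines the pair and solutions inject into the roots of
  \<open>H\<close>. Nonemptiness of \<open>J\<close> permits the division by
  \<open>card J\<close>.\<close>

lemma card_likelihood_solutions_le_degree:
  assumes fin: "finite I" "finite J" and J: "J \<noteq> {}"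
    and i0: "i0 \<in> I" "l i0 = 0"
    and H: "H \<noteq> 0"
    and root: "\<And>a b. (a, b) \<in> likelihood_solutions I l t J m \<Longrightarrow> poly H (a / b) = 0"
  shows "finite (likelihood_solutions I l t J m) \<and> card (likelihood_solutions I l t J m) \<le> degree H"
proof -
  let ?S = "likelihood_solutions I l t J m"
  note ratio = likelihood_solutions_ratio[of I J i0 l, OF fin J i0]
  have "inj_on (\<lambda>(a, b). a / b) ?S"
  proof (rule inj_onI, clarsimp)
    fix a b a' b' assume s: "(a, b) \<in> ?S" "(a', b') \<in> ?S" and e: "a / b = a' / b'"
    have "of_nat (card J) * b = of_nat (card J) * b'"
      using ratio(4)[OF s(1)] ratio(4)[OF s(2)] e by simp
    then have "b = b'" using fin(2) J by simp
    with e ratio(1)[OF s(1)] show "a = a' \<and> b = b'" by simp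
  qed
  moreover have "(\<lambda>(a, b). a / b) ` ?S \<subseteq> {x. poly H x = 0}" using root by auto
  moreover have "finite {x. poly H x = 0}" "card {x. poly H x = 0} \<le> degree H"
    using H by (auto simp: poly_roots_finite card_poly_roots_bound)
  ultimately show ?thesis
    by (meson card_inj_on_le finite_imageD finite_subset le_trans)
qed

text \<open>With x = a / b, the two identities for \<open>b\<close> read card J * b = F / P and b *
  D' / D = G / P^2. Eliminating \<open>b\<close> and clearing denominators yields F P D' = card J *
  G D. The bound is stated with \<open>+ 1\<close> to avoid truncated subtraction.\<close>

lemma card_likelihood_solutions:
  fixes l t :: "'i \<Rightarrow> complex" and m :: "'j \<Rightarrow> complex"
  assumes fin: "finite I" "finite J"
    and i0: "i0 \<in> I" "l i0 = 0"
    and t0: "(\<Sum>i | i \<in> I \<and> l i = 0. t i) \<noteq> 0"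
    and j0: "j0 \<in> J" "m j0 \<noteq> 0"
  shows "finite (likelihood_solutions I l t J m)" (is "finite ?S")
    and "card (likelihood_solutions I l t J m) + 1 \<le> 2 * card {i\<in>I. l i \<noteq> 0} + card {j\<in>J. m j \<noteq> 0}"
proof -
  define A where "A = {i\<in>I. l i \<noteq> 0}"
  define B where "B = {j\<in>J. m j \<noteq> 0}"
  define t0' where "t0' = (\<Sum>i | i \<in> I \<and> l i = 0. t i)"
  have A: "finite A" "\<And>i. i \<in> A \<Longrightarrow> l i \<noteq> 0" using fin by (auto simp: A_def)
  have B: "finite B" "\<And>j. j \<in> B \<Longrightarrow> m j \<noteq> 0" using fin by (auto simp: B_def)
  have J: "J \<noteq> {}" using j0 by auto
  have Bpos: "card B > 0" using j0 B(1) by (auto simp: card_gt_0_iff B_def)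
  note ratio = likelihood_solutions_ratio[of I J i0 l, OF fin J i0, folded A_def]
  define F where "F = quad_poly t0' A l t"
  define G where "G = quad_sq_poly A l t"
  define P where "P = affine_prod A l"
  define D where "D = affine_prod B m"
  \<comment> \<open>The dominant side of the eliminant: \<open>F\<close> and \<open>P\<close> have
    degree \<open>card A\<close> each, and in characteristic zero \<open>pderiv D\<close> has degree
    exactly \<open>card B - 1\<close>.\<close>
  define H1 where "H1 = F * P * pderiv D"
  define H2 where "H2 = Polynomial.smult (of_nat (card J)) (G * D)"
  have F: "degree F = card A" "F \<noteq> 0"
    unfolding F_def using degree_quad_poly[of A l t0' t, OF A] t0 by (auto simp: t0'_def)
  have P: "degree P = card A" "P \<noteq> 0"
    unfolding P_def using degree_affine_prod[OF A] affine_prod_nonzero by auto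
  have D: "degree D = card B" "D \<noteq> 0"
    unfolding D_def using degree_affine_prod[OF B] affine_prod_nonzero by auto
  have dD: "degree (pderiv D) = card B - 1" "pderiv D \<noteq> 0"
    using D Bpos by (auto simp: degree_pderiv pderiv_eq_0_iff)
  have H1: "H1 \<noteq> 0" "degree H1 = 2 * card A + (card B - 1)"
    unfolding H1_def using F P dD by (auto simp: degree_mult_eq)
  \<comment> \<open>For empty \<open>A\<close> the truncated bound
    \<open>2 * (card A - 1) + card B\<close> would exceed the degree \<open>card B - 1\<close> of
    \<open>H1\<close>; there \<open>G\<close> is an empty sum and \<open>H2\<close>
    vanishes.\<close>
  have H2: "H2 = 0 \<or> degree H2 < degree H1"
  proof (cases "A = {}")
    case True
    then show ?thesis by (simp add: H2_def G_def quad_sq_poly_def)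
  next
    case False
    then have "card A > 0" using A(1) by (simp add: card_gt_0_iff)
    moreover have "degree H2 \<le> 2 * (card A - 1) + card B"
      unfolding H2_def using degree_quad_sq_poly[of A l t, OF A] degree_mult_le[of G D] D
      by (auto simp: G_def intro: order_trans[OF degree_smult_le])
    ultimately show ?thesis using H1(2) Bpos by linarith
  qed
  note H = degree_diff_dominant[OF H1(1) H2]
  have root: "poly (H1 - H2) (a / b) = 0" if s: "(a, b) \<in> ?S" for a b
  proof -
    define x where "x = a / b"
    note r = ratio[OF s, folded x_def t0'_def]
    have nz: "\<And>i. i \<in> A \<Longrightarrow> 1 + x * l i \<noteq> 0" "\<And>j. j \<in> B \<Longrightarrow> 1 + x * m j \<noteq> 0"
      using r(2,3) by (auto simp: A_def B_def)
    have dB: "(\<Sum>j\<in>J. m j / (1 + x * m j)) = (\<Sum>j\<in>B. m j / (1 + x * m j))"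
      using fin(2) by (intro sum.mono_neutral_right) (auto simp: B_def)
    have Fx: "poly F x = poly P x * (of_nat (card J) * b)"
      unfolding F_def P_def r(4) by (rule poly_quad_poly[OF A(1) nz(1)])
    have Gx: "poly G x = (poly P x)\<^sup>2 * (b * (\<Sum>j\<in>B. m j / (1 + x * m j)))"
      unfolding G_def P_def dB[symmetric] r(5) by (rule poly_quad_sq_poly[OF A(1) nz(1)])
    have Dx: "poly (pderiv D) x = poly D x * (\<Sum>j\<in>B. m j / (1 + x * m j))"
      unfolding D_def by (rule poly_pderiv_affine_prod[OF B(1) nz(2)])
    show ?thesis unfolding x_def[symmetric] H1_def H2_def
      by (simp add: Fx Gx Dx power2_eq_square)
  qed
  have c: "finite ?S \<and> card ?S \<le> degree (H1 - H2)"
    by (rule card_likelihood_solutions_le_degree[of I J i0 l, OF fin J i0 H(1) root])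
  then show "finite ?S" by simp
  show "card ?S + 1 \<le> 2 * card A + card B"
    using c unfolding H(2) H1(2) using Bpos by linarith
qed

text \<open>When both spectra agree, a common factor of the eliminant cancels, which saves one copy of
  the number of nonzero eigenvalues.\<close>

lemma card_likelihood_solutions_same:
  fixes l t :: "'i \<Rightarrow> complex"
  assumes fin: "finite I"
    and i0: "i0 \<in> I" "l i0 = 0"
    and t0: "(\<Sum>i | i \<in> I \<and> l i = 0. t i) \<noteq> 0"
    and j0: "j0 \<in> I" "l j0 \<noteq> 0"
  shows "finite (likelihood_solutions I l t I l)" (is "finite ?S")
    and "card (likelihood_solutions I l t I l) + 1 \<le> 2 * card {i\<in>I. l i \<noteq> 0}"
proof -
  define A where "A = {i\<in>I. l i \<noteq> 0}"
  define t0' where "t0' = (\<Sum>i | i \<in> I \<and> l i = 0. t i)"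
  have A: "finite A" "\<And>i. i \<in> A \<Longrightarrow> l i \<noteq> 0" using fin by (auto simp: A_def)
  have I: "I \<noteq> {}" using j0 by auto
  have Apos: "card A > 0" using j0 A(1) by (auto simp: card_gt_0_iff A_def)
  note ratio = likelihood_solutions_ratio[of I I i0 l, OF fin fin I i0, folded A_def]
  define F where "F = quad_poly t0' A l t"
  define G where "G = quad_sq_poly A l t"
  define P where "P = affine_prod A l"
  \<comment> \<open>Here D = P, and dividing F P P' = card I * G P by P leaves F P' = card I * G, of
    degree 2 card A - 1 instead of 3 card A - 1.\<close>
  define H1 where "H1 = F * pderiv P"
  define H2 where "H2 = Polynomial.smult (of_nat (card I)) G"
  have F: "degree F = card A" "F \<noteq> 0"
    unfolding F_def using degree_quad_poly[of A l t0' t, OF A] t0 by (auto simp: t0'_def)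
  have P: "degree P = card A" "P \<noteq> 0"
    unfolding P_def using degree_affine_prod[OF A] affine_prod_nonzero by auto
  have dP: "degree (pderiv P) = card A - 1" "pderiv P \<noteq> 0"
    using P Apos by (auto simp: degree_pderiv pderiv_eq_0_iff)
  have H1: "H1 \<noteq> 0" "degree H1 = card A + (card A - 1)"
    unfolding H1_def using F dP by (auto simp: degree_mult_eq)
  have "degree H2 \<le> 2 * (card A - 1)"
    unfolding H2_def using degree_quad_sq_poly[of A l t, OF A]
    by (auto simp: G_def intro: order_trans[OF degree_smult_le])
  then have "H2 = 0 \<or> degree H2 < degree H1" using H1(2) Apos by linarith
  note H = degree_diff_dominant[OF H1(1) this]
  have root: "poly (H1 - H2) (a / b) = 0" if s: "(a, b) \<in> ?S" for a b
  proof -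
    define x where "x = a / b"
    note r = ratio[OF s, folded x_def t0'_def]
    have nz: "\<And>i. i \<in> A \<Longrightarrow> 1 + x * l i \<noteq> 0" using r(2) by (auto simp: A_def)
    have dB: "(\<Sum>j\<in>I. l j / (1 + x * l j)) = (\<Sum>j\<in>A. l j / (1 + x * l j))"
      using fin by (intro sum.mono_neutral_right) (auto simp: A_def)
    have Fx: "poly F x = poly P x * (of_nat (card I) * b)"
      unfolding F_def P_def r(4) by (rule poly_quad_poly[OF A(1) nz])
    have Gx: "poly G x = (poly P x)\<^sup>2 * (b * (\<Sum>j\<in>A. l j / (1 + x * l j)))"
      unfolding G_def P_def dB[symmetric] r(5) by (rule poly_quad_sq_poly[OF A(1) nz])
    have Px: "poly (pderiv P) x = poly P x * (\<Sum>j\<in>A. l j / (1 + x * l j))"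
      unfolding P_def by (rule poly_pderiv_affine_prod[OF A(1) nz])
    show ?thesis unfolding x_def[symmetric] H1_def H2_def
      by (simp add: Fx Gx Px power2_eq_square)
  qed
  have c: "finite ?S \<and> card ?S \<le> degree (H1 - H2)"
    by (rule card_likelihood_solutions_le_degree[of I I i0 l, OF fin fin I i0 H(1) root])
  then show "finite ?S" by simp
  show "card ?S + 1 \<le> 2 * card A"
    using c unfolding H(2) H1(2) using Apos by linarith
qed

section \<open>Calculus of orthogonally diagonalized matrices\<close>

definition diag_fun :: "nat \<Rightarrow> (nat \<Rightarrow> 'a) \<Rightarrow> 'a :: zero mat" where
  "diag_fun n f = Matrix.mat n n (\<lambda>(i, j). if i = j then f i else 0)"

lemma diag_fun_carrier [simp]: "diag_fun n f \<in> carrier_mat n n"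
  by (simp add: diag_fun_def)

lemma diag_fun_mult_vec:
  fixes f :: "nat \<Rightarrow> 'a :: comm_semiring_1"
  assumes "v \<in> carrier_vec n"
  shows "diag_fun n f *\<^sub>v v = Matrix.vec n (\<lambda>i. f i * v $ i)"
proof (rule eq_vecI)
  fix i assume "i < dim_vec (Matrix.vec n (\<lambda>i. f i * v $ i))"
  then have i: "i < n" by simp
  have "(diag_fun n f *\<^sub>v v) $ i = (\<Sum>j<n. (if i = j then f i else 0) * v $ j)"
    using i assms by (simp add: diag_fun_def scalar_prod_def atLeast0LessThan)
  also have "\<dots> = (\<Sum>j<n. if j = i then f i * v $ i else 0)"
    by (intro sum.cong) auto
  finally show "(diag_fun n f *\<^sub>v v) $ i = Matrix.vec n (\<lambda>i. f i * v $ i) $ i"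
    using i by simp
qed (simp add: diag_fun_def)

lemma diag_fun_mult:
  fixes f g :: "nat \<Rightarrow> 'a :: comm_semiring_1"
  shows "diag_fun n f * diag_fun n g = diag_fun n (\<lambda>i. f i * g i)"
proof (rule eq_matI)
  fix i j assume "i < dim_row (diag_fun n (\<lambda>i. f i * g i))" "j < dim_col (diag_fun n (\<lambda>i. f i * g i))"
  then have ij: "i < n" "j < n" by (auto simp: diag_fun_def)
  have "(diag_fun n f * diag_fun n g) $$ (i, j) = (diag_fun n f *\<^sub>v col (diag_fun n g) j) $ i"
    using ij by (simp add: diag_fun_def)
  also have "\<dots> = f i * diag_fun n g $$ (i, j)"
    using ij by (subst diag_fun_mult_vec) (auto simp: diag_fun_def)
  finally show "(diag_fun n f * diag_fun n g) $$ (i, j) = diag_fun n (\<lambda>i. f i * g i) $$ (i, j)"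
    using ij by (simp add: diag_fun_def)
qed (auto simp: diag_fun_def)

text \<open>Functional calculus for the symmetric matrices with eigenvectors the columns of
  \<open>Q\<close>. For orthonormal \<open>Q\<close>, products and inverses are pointwise in
  \<open>f\<close>, and the trace is the sum of \<open>f\<close>.\<close>

definition conj_diag :: "'a :: comm_semiring_1 mat \<Rightarrow> (nat \<Rightarrow> 'a) \<Rightarrow> 'a mat" where
  "conj_diag Q f = Q * diag_fun (dim_col Q) f * transpose_mat Q"

lemma smult_mat_mult_vec:
  fixes A :: "'a :: comm_ring mat"
  assumes "A \<in> carrier_mat n m" "v \<in> carrier_vec m"
  shows "(a \<cdot>\<^sub>m A) *\<^sub>v v = a \<cdot>\<^sub>v (A *\<^sub>v v)"
proof (rule eq_vecI)
  fix i assume "i < dim_vec (a \<cdot>\<^sub>v (A *\<^sub>v v))"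
  then have i: "i < n" using assms by simp
  have "Matrix.row A i \<in> carrier_vec m" using assms(1) i by (metis row_carrier_vec)
  then show "((a \<cdot>\<^sub>m A) *\<^sub>v v) $ i = (a \<cdot>\<^sub>v (A *\<^sub>v v)) $ i"
    using assms i by (simp add: smult_scalar_prod_distrib[of _ m])
qed simp

lemma mat_eq_by_mult_vec:
  fixes A B :: "'a :: comm_semiring_1 mat"
  assumes "A \<in> carrier_mat n m" "B \<in> carrier_mat n m"
    and "\<And>v. v \<in> carrier_vec m \<Longrightarrow> A *\<^sub>v v = B *\<^sub>v v"
  shows "A = B"
proof (rule eq_matI)
  fix i j assume ij: "i < dim_row B" "j < dim_col B"
  have "(A *\<^sub>v unit_vec m j) $ i = (B *\<^sub>v unit_vec m j) $ i" using assms(3) by simp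
  then show "A $$ (i, j) = B $$ (i, j)" using ij assms(1,2) by simp
qed (use assms in auto)

lemma mat_trace_comm:
  fixes A B :: "'a :: comm_semiring_0 mat"
  assumes "A \<in> carrier_mat n m" "B \<in> carrier_mat m n"
  shows "mat_trace (A * B) = mat_trace (B * A)"
proof -
  have "mat_trace (A * B) = (\<Sum>i<n. \<Sum>j<m. A $$ (i,j) * B $$ (j,i))"
    using assms by (simp add: mat_trace_def scalar_prod_def atLeast0LessThan)
  also have "\<dots> = (\<Sum>j<m. \<Sum>i<n. B $$ (j,i) * A $$ (i,j))"
    by (subst sum.swap) (simp add: mult.commute)
  also have "\<dots> = mat_trace (B * A)"
    using assms by (simp add: mat_trace_def scalar_prod_def atLeast0LessThan)
  finally show ?thesis .
qed

text \<open>Stated over any field and with the plain transpose, so that it applies to a real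
  orthogonal matrix and equally to its complexification.\<close>

locale orthonormal_mat =
  fixes Q :: "'a :: field mat" and n :: nat
  assumes Q: "Q \<in> carrier_mat n n"
    and left: "transpose_mat Q * Q = 1\<^sub>m n" and right: "Q * transpose_mat Q = 1\<^sub>m n"
begin

lemma dims [simp]: "dim_row Q = n" "dim_col Q = n" "transpose_mat Q \<in> carrier_mat n n"
  using Q by auto

lemma conj_diag_carrier [simp]: "conj_diag Q f \<in> carrier_mat n n"
  unfolding conj_diag_def by (rule carrier_matI) auto

lemma col_carrier [simp]: "col Q i \<in> carrier_vec n"
  by (rule carrier_vecI) simp

lemma transpose_mult_vec: "i < n \<Longrightarrow> (transpose_mat Q *\<^sub>v v) $ i = col Q i \<bullet> v"
  by simp

lemma col_orthonormal:
  assumes "i < n" "j < n" shows "col Q i \<bullet> col Q j = (if i = j then 1 else 0)"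
proof -
  have "col Q i \<bullet> col Q j = (transpose_mat Q * Q) $$ (i, j)" using assms by simp
  then show ?thesis unfolding left using assms by simp
qed

lemma col_nonzero: "i < n \<Longrightarrow> col Q i \<noteq> 0\<^sub>v n"
  using col_orthonormal[of i i] by fastforce

lemma parseval:
  assumes "u \<in> carrier_vec n" "v \<in> carrier_vec n"
  shows "u \<bullet> v = (\<Sum>i<n. (col Q i \<bullet> u) * (col Q i \<bullet> v))"
proof -
  have "u \<bullet> v = u \<bullet> ((Q * transpose_mat Q) *\<^sub>v v)" unfolding right using assms by simp
  also have "\<dots> = u \<bullet> (Q *\<^sub>v (transpose_mat Q *\<^sub>v v))"
    using assms Q by (subst assoc_mult_mat_vec) auto
  also have "\<dots> = (transpose_mat Q *\<^sub>v u) \<bullet> (transpose_mat Q *\<^sub>v v)"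
    by (rule transpose_vec_mult_scalar[OF Q mult_mat_vec_carrier[OF dims(3) assms(2)] assms(1), symmetric])
  also have "\<dots> = (\<Sum>i<n. (col Q i \<bullet> u) * (col Q i \<bullet> v))"
    by (simp add: scalar_prod_def[of "transpose_mat Q *\<^sub>v u"] atLeast0LessThan)
  finally show ?thesis .
qed

lemma eq_vec_by_coords:
  assumes u: "u \<in> carrier_vec n" and v: "v \<in> carrier_vec n"
    and e: "\<And>i. i < n \<Longrightarrow> col Q i \<bullet> u = col Q i \<bullet> v"
  shows "u = v"
proof (rule eq_vecI)
  fix k assume "k < dim_vec v"
  then have k: "k < n" using v by simp
  have "unit_vec n k \<bullet> u = unit_vec n k \<bullet> v"
    unfolding parseval[OF unit_vec_carrier u] parseval[OF unit_vec_carrier v] using e by simp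
  then show "u $ k = v $ k" using u v k by simp
qed (use u v in auto)

lemma conj_diag_mult: "conj_diag Q f * conj_diag Q g = conj_diag Q (\<lambda>i. f i * g i)"
proof -
  let ?T = "transpose_mat Q" and ?F = "diag_fun n f" and ?G = "diag_fun n g"
  have "conj_diag Q f * conj_diag Q g = (Q * ?F) * (?T * ((Q * ?G) * ?T))"
    unfolding conj_diag_def dims using Q by (intro assoc_mult_mat[of _ n n _ n _ n]) auto
  also have "?T * ((Q * ?G) * ?T) = (?T * (Q * ?G)) * ?T"
    using Q by (intro assoc_mult_mat[of _ n n _ n _ n, symmetric]) auto
  also have "?T * (Q * ?G) = (?T * Q) * ?G"
    using Q by (intro assoc_mult_mat[of _ n n _ n _ n, symmetric]) auto
  also have "\<dots> = ?G" unfolding left by (rule left_mult_one_mat) (rule diag_fun_carrier)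
  also have "Q * ?F * (?G * ?T) = (Q * ?F) * ?G * ?T"
    using Q by (intro assoc_mult_mat[of _ n n _ n _ n, symmetric]) auto
  also have "Q * ?F * ?G = Q * (?F * ?G)"
    using Q by (intro assoc_mult_mat[of _ n n _ n _ n]) auto
  finally show ?thesis unfolding conj_diag_def by (simp add: diag_fun_mult)
qed

lemma conj_diag_one: "conj_diag Q (\<lambda>_. 1) = 1\<^sub>m n"
proof -
  have "diag_fun n (\<lambda>_. 1) = (1\<^sub>m n :: 'a mat)" by (rule eq_matI) (auto simp: diag_fun_def)
  then show ?thesis unfolding conj_diag_def using Q right by simp
qed

lemma conj_diag_coord:
  assumes "v \<in> carrier_vec n" "i < n"
  shows "col Q i \<bullet> (conj_diag Q f *\<^sub>v v) = f i * (col Q i \<bullet> v)"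
proof -
  let ?T = "transpose_mat Q" and ?D = "diag_fun n f"
  have Tv: "?T *\<^sub>v v \<in> carrier_vec n" using assms(1) by (rule mult_mat_vec_carrier[OF dims(3)])
  have QD: "Q * ?D \<in> carrier_mat n n" using Q by (rule mult_carrier_mat) (rule diag_fun_carrier)
  have "conj_diag Q f *\<^sub>v v = (Q * ?D) *\<^sub>v (?T *\<^sub>v v)"
    unfolding conj_diag_def dims by (rule assoc_mult_mat_vec[OF QD dims(3) assms(1)])
  also have "\<dots> = Q *\<^sub>v (?D *\<^sub>v (?T *\<^sub>v v))"
    by (rule assoc_mult_mat_vec[OF Q diag_fun_carrier Tv])
  finally have "?T *\<^sub>v (conj_diag Q f *\<^sub>v v) = ?T *\<^sub>v (Q *\<^sub>v (?D *\<^sub>v (?T *\<^sub>v v)))"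
    by simp
  also have "\<dots> = (?T * Q) *\<^sub>v (?D *\<^sub>v (?T *\<^sub>v v))"
    by (rule assoc_mult_mat_vec[symmetric, OF dims(3) Q mult_mat_vec_carrier[OF diag_fun_carrier Tv]])
  also have "\<dots> = diag_fun n f *\<^sub>v (?T *\<^sub>v v)"
    unfolding left by (rule one_mult_mat_vec) (rule mult_mat_vec_carrier[OF diag_fun_carrier Tv])
  also have "\<dots> = Matrix.vec n (\<lambda>i. f i * (?T *\<^sub>v v) $ i)"
    by (rule diag_fun_mult_vec[OF Tv])
  finally have "(?T *\<^sub>v (conj_diag Q f *\<^sub>v v)) $ i = f i * (?T *\<^sub>v v) $ i"
    using assms(2) by simp
  then show ?thesis unfolding transpose_mult_vec[OF assms(2)] .
qed

lemma conj_diag_cong: "(\<And>i. i < n \<Longrightarrow> f i = g i) \<Longrightarrow> conj_diag Q f = conj_diag Q g"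
  unfolding conj_diag_def dims
  by (rule arg_cong[of "diag_fun n f" "diag_fun n g" "\<lambda>D. Q * D * transpose_mat Q"],
      rule eq_matI) (auto simp: diag_fun_def)

lemma conj_diag_linear: "a \<cdot>\<^sub>m conj_diag Q f + b \<cdot>\<^sub>m 1\<^sub>m n = conj_diag Q (\<lambda>i. a * f i + b)"
proof (rule mat_eq_by_mult_vec[of _ n n])
  fix v :: "'a Matrix.vec" assume v: "v \<in> carrier_vec n"
  have Av: "conj_diag Q g *\<^sub>v v \<in> carrier_vec n" for g
    using v by (rule mult_mat_vec_carrier[OF conj_diag_carrier])
  have e: "(a \<cdot>\<^sub>m conj_diag Q f + b \<cdot>\<^sub>m 1\<^sub>m n) *\<^sub>v v = a \<cdot>\<^sub>v (conj_diag Q f *\<^sub>v v) + b \<cdot>\<^sub>v v"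
    using v by (simp add: add_mult_distrib_mat_vec[of _ n n] smult_mat_mult_vec[of _ n n])
  show "(a \<cdot>\<^sub>m conj_diag Q f + b \<cdot>\<^sub>m 1\<^sub>m n) *\<^sub>v v = conj_diag Q (\<lambda>i. a * f i + b) *\<^sub>v v"
    unfolding e
  proof (rule eq_vec_by_coords)
    fix k assume k: "k < n"
    have "col Q k \<bullet> (a \<cdot>\<^sub>v (conj_diag Q f *\<^sub>v v) + b \<cdot>\<^sub>v v)
        = a * (col Q k \<bullet> (conj_diag Q f *\<^sub>v v)) + b * (col Q k \<bullet> v)"
      using v Av[of f] by (simp add: scalar_prod_add_distrib[of _ n] scalar_prod_smult_distrib[of _ n])
    then show "col Q k \<bullet> (a \<cdot>\<^sub>v (conj_diag Q f *\<^sub>v v) + b \<cdot>\<^sub>v v)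
        = col Q k \<bullet> (conj_diag Q (\<lambda>i. a * f i + b) *\<^sub>v v)"
      unfolding conj_diag_coord[OF v k] by (simp add: distrib_right mult.assoc)
  qed (use v Av in auto)
qed auto

lemma conj_diag_trace: "mat_trace (conj_diag Q f) = (\<Sum>i<n. f i)"
proof -
  have "mat_trace (conj_diag Q f) = mat_trace (transpose_mat Q * (Q * diag_fun n f))"
    unfolding conj_diag_def dims by (rule mat_trace_comm[of _ n n]) (use Q in auto)
  also have "transpose_mat Q * (Q * diag_fun n f) = (transpose_mat Q * Q) * diag_fun n f"
    using Q by (intro assoc_mult_mat[of _ n n _ n _ n, symmetric]) auto
  finally show ?thesis unfolding left left_mult_one_mat[OF diag_fun_carrier]
    by (simp add: mat_trace_def diag_fun_def)
qed

lemma conj_diag_quadratic: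
  assumes "v \<in> carrier_vec n"
  shows "v \<bullet> (conj_diag Q f *\<^sub>v v) = (\<Sum>i<n. f i * (col Q i \<bullet> v)\<^sup>2)"
  unfolding parseval[OF assms mult_mat_vec_carrier[OF conj_diag_carrier assms]]
  using assms by (intro sum.cong) (simp_all add: conj_diag_coord power2_eq_square)

lemma conj_diag_inverse:
  assumes "\<And>i. i < n \<Longrightarrow> f i \<noteq> 0"
  shows "conj_diag Q f * conj_diag Q (\<lambda>i. 1 / f i) = 1\<^sub>m n"
proof -
  have "conj_diag Q (\<lambda>i. f i * (1 / f i)) = conj_diag Q (\<lambda>_. 1)"
    using assms by (intro conj_diag_cong) auto
  then show ?thesis by (simp only: conj_diag_mult conj_diag_one)
qed

text \<open>If \<open>f i = 0\<close>, every vector in the range has coordinate 0 along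
  \<open>col Q i\<close>, so \<open>col Q i\<close> itself is not reached. Otherwise the pointwise
  reciprocal is an inverse.\<close>

lemma invertible_conj_diag_iff: "invertible_mat (conj_diag Q f) \<longleftrightarrow> (\<forall>i<n. f i \<noteq> 0)"
proof
  assume "invertible_mat (conj_diag Q f)"
  then obtain B where B: "B * conj_diag Q f = 1\<^sub>m (dim_row B)" "conj_diag Q f * B = 1\<^sub>m n"
    unfolding invertible_mat_def inverts_mat_def using carrier_matD[OF conj_diag_carrier] by auto
  have Bc: "B \<in> carrier_mat n n"
    using arg_cong[OF B(1), of dim_col] arg_cong[OF B(2), of dim_col] carrier_matD[OF conj_diag_carrier]
    by auto
  show "\<forall>i<n. f i \<noteq> 0"
  proof (intro allI impI notI)
    fix i assume i: "i < n" "f i = 0"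
    have "conj_diag Q f *\<^sub>v (B *\<^sub>v col Q i) = (conj_diag Q f * B) *\<^sub>v col Q i"
      using Bc by (intro assoc_mult_mat_vec[of _ n n _ n, symmetric]) auto
    then have "col Q i \<bullet> col Q i = col Q i \<bullet> (conj_diag Q f *\<^sub>v (B *\<^sub>v col Q i))"
      unfolding B(2) by simp
    also have "\<dots> = 0" using i Bc by (subst conj_diag_coord) auto
    finally show False using col_orthonormal[of i i] i by simp
  qed
next
  assume f: "\<forall>i<n. f i \<noteq> 0"
  then have a: "conj_diag Q f * conj_diag Q (\<lambda>i. 1 / f i) = 1\<^sub>m n"
    by (intro conj_diag_inverse) auto
  then have "conj_diag Q (\<lambda>i. 1 / f i) * conj_diag Q f = 1\<^sub>m n"
    by (intro mat_mult_left_right_inverse[OF _ _ a]) auto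
  with a show "invertible_mat (conj_diag Q f)"
    unfolding invertible_mat_def inverts_mat_def using carrier_matD[OF conj_diag_carrier] by auto
qed

lemma mat_inverse_conj_diag:
  assumes f: "\<And>i. i < n \<Longrightarrow> f i \<noteq> 0"
  shows "the (mat_inverse (conj_diag Q f)) = conj_diag Q (\<lambda>i. 1 / f i)"
proof -
  let ?A = "conj_diag Q f" and ?B = "conj_diag Q (\<lambda>i. 1 / f i)"
  have AB: "?A * ?B = 1\<^sub>m n" using f by (rule conj_diag_inverse)
  have BA: "?B * ?A = 1\<^sub>m n" by (intro mat_mult_left_right_inverse[OF _ _ AB]) auto
  have "?A \<in> Units (ring_mat TYPE('a) n ())"
    unfolding Units_def ring_mat_def using AB BA by auto
  then obtain C where C: "mat_inverse ?A = Some C"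
    using mat_inverse(1)[OF conj_diag_carrier, where b = "()"] by (cases "mat_inverse ?A") blast+
  then have *: "C * ?A = 1\<^sub>m n" "C \<in> carrier_mat n n"
    using mat_inverse(2)[OF conj_diag_carrier C] by auto
  have "C = C * (?A * ?B)" unfolding AB using * by simp
  also have "\<dots> = (C * ?A) * ?B" using * by (intro assoc_mult_mat[of _ n n _ n _ n, symmetric]) auto
  also have "\<dots> = ?B" unfolding * by (rule left_mult_one_mat[OF conj_diag_carrier])
  finally show ?thesis using C by simp
qed

end

section \<open>The centered model\<close>

lemma symmetric_conj_diag:
  fixes A :: "real mat"
  assumes A: "A \<in> carrier_mat n n" "transpose_mat A = A"
  obtains Q l where "orthonormal_mat Q n" "A = conj_diag Q l"
proof -
  obtain Q l where Q: "Q \<in> carrier_mat n n" "transpose_mat Q * Q = 1\<^sub>m n" "Q * transpose_mat Q = 1\<^sub>m n"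
    and D: "transpose_mat Q * A * Q = Matrix.mat n n (\<lambda>(i,j). if i = j then l i else 0)"
    using symmetric_diagonalization[OF A] by blast
  let ?T = "transpose_mat Q"
  have T: "?T \<in> carrier_mat n n" using Q by simp
  have "conj_diag Q l = Q * (?T * A * Q) * ?T"
    unfolding conj_diag_def D diag_fun_def using Q(1) by simp
  also have "\<dots> = Q * (?T * (A * Q)) * ?T"
    using assoc_mult_mat[OF T A(1) Q(1)] by simp
  also have "Q * (?T * (A * Q)) = (Q * ?T) * (A * Q)"
    using assoc_mult_mat[OF Q(1) T mult_carrier_mat[OF A(1) Q(1)]] by simp
  also have "\<dots> = A * Q" unfolding Q(3) by (rule left_mult_one_mat[OF mult_carrier_mat[OF A(1) Q(1)]])
  also have "A * Q * ?T = A * (Q * ?T)" by (rule assoc_mult_mat[OF A(1) Q(1) T])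
  also have "\<dots> = A" unfolding Q(3) using A by simp
  finally have "A = conj_diag Q l" ..
  then show thesis using that[of Q l] Q by (auto simp: orthonormal_mat_def)
qed

section \<open>Complexification of real orthonormal bases and covariances\<close>

abbreviation cmat :: "real mat \<Rightarrow> complex mat" where "cmat \<equiv> map_mat complex_of_real"
abbreviation cvec :: "real Matrix.vec \<Rightarrow> complex Matrix.vec" where "cvec \<equiv> map_vec complex_of_real"

lemma cmat_mult: "A \<in> carrier_mat n m \<Longrightarrow> B \<in> carrier_mat m k \<Longrightarrow> cmat (A * B) = cmat A * cmat B"
  by (rule of_real_hom.mat_hom_mult)

lemma cmat_mult_vec: "A \<in> carrier_mat n m \<Longrightarrow> v \<in> carrier_vec m \<Longrightarrow> cvec (A *\<^sub>v v) = cmat A *\<^sub>v cvec v"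
  by (rule of_real_hom.mult_mat_vec_hom)

lemma cvec_scalar_prod:
  assumes "u \<in> carrier_vec n" "v \<in> carrier_vec n"
  shows "cvec u \<bullet> cvec v = complex_of_real (u \<bullet> v)"
  using assms by (simp add: scalar_prod_def)

lemma orthonormal_mat_cmat:
  assumes "orthonormal_mat Q n" shows "orthonormal_mat (cmat Q) n"
proof -
  interpret orthonormal_mat Q n by fact
  show ?thesis
  proof
    show "cmat Q \<in> carrier_mat n n" using Q by simp
    have "transpose_mat (cmat Q) = cmat (transpose_mat Q)" by (rule map_mat_transpose)
    then show "transpose_mat (cmat Q) * cmat Q = 1\<^sub>m n" "cmat Q * transpose_mat (cmat Q) = 1\<^sub>m n"
      using cmat_mult[OF dims(3) Q] cmat_mult[OF Q dims(3)] left right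
      by (simp_all add: of_real_hom.mat_hom_one)
  qed
qed

lemma cmat_conj_diag:
  assumes "orthonormal_mat Q n"
  shows "cmat (conj_diag Q l) = conj_diag (cmat Q) (\<lambda>i. complex_of_real (l i))"
proof -
  interpret orthonormal_mat Q n by fact
  have D: "cmat (diag_fun n l) = diag_fun n (\<lambda>i. complex_of_real (l i))"
    by (rule eq_matI) (auto simp: diag_fun_def)
  show ?thesis unfolding conj_diag_def dims index_map_mat
      cmat_mult[OF mult_carrier_mat[OF Q diag_fun_carrier] dims(3)] cmat_mult[OF Q diag_fun_carrier] D
    by (simp add: map_mat_transpose)
qed

lemma covariance_conj_diag:
  assumes "orthonormal_mat Q n"
  shows "covariance (conj_diag Q l) (a, b) = conj_diag (cmat Q) (\<lambda>i. a * complex_of_real (l i) + b)"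
proof -
  interpret orthonormal_mat Q n by fact
  interpret c: orthonormal_mat "cmat Q" n by (rule orthonormal_mat_cmat) fact
  show ?thesis unfolding covariance_def cmat_conj_diag[OF assms]
    using carrier_matD(1)[OF conj_diag_carrier] c.conj_diag_linear by simp
qed

text \<open>All matrices are functions in the same eigenbasis, so the translation is exact for every
  \<open>z\<close>. If a denominator vanishes, the covariance is singular and both sides exclude the
  pair.\<close>

lemma centered_ml_solutions_conj_diag:
  assumes "orthonormal_mat Q n" and z: "z \<in> carrier_vec n"
  shows "centered_ml_solutions (conj_diag Q l) z =
    likelihood_solutions {..<n} (\<lambda>i. complex_of_real (l i)) (\<lambda>i. complex_of_real ((col Q i \<bullet> z)\<^sup>2))
      {..<n} (\<lambda>i. complex_of_real (l i))"
proof -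
  interpret orthonormal_mat Q n by fact
  interpret c: orthonormal_mat "cmat Q" n by (rule orthonormal_mat_cmat) fact
  have zc: "cvec z \<in> carrier_vec n" using z by simp
  have "(a, b) \<in> centered_ml_solutions (conj_diag Q l) z \<longleftrightarrow>
    (a, b) \<in> likelihood_solutions {..<n} (\<lambda>i. complex_of_real (l i)) (\<lambda>i. complex_of_real ((col Q i \<bullet> z)\<^sup>2))
      {..<n} (\<lambda>i. complex_of_real (l i))" for a b
  proof (cases "\<forall>i<n. a * complex_of_real (l i) + b \<noteq> 0")
    case False
    then show ?thesis
      by (auto simp: centered_ml_solutions_def likelihood_solutions_def covariance_conj_diag[OF assms(1)]
          c.invertible_conj_diag_iff)
  next
    case True
    then have S: "the (mat_inverse (conj_diag (cmat Q) (\<lambda>i. a * complex_of_real (l i) + b)))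
      = conj_diag (cmat Q) (\<lambda>i. 1 / (a * complex_of_real (l i) + b))"
      by (intro c.mat_inverse_conj_diag) auto
    show ?thesis using True
      unfolding centered_ml_solutions_def likelihood_solutions_def
      by (simp add: covariance_conj_diag[OF assms(1)] c.invertible_conj_diag_iff Let_def S
          cmat_conj_diag[OF assms(1)] c.conj_diag_mult c.conj_diag_trace c.conj_diag_quadratic[OF zc]
          power2_eq_square Ball_def cvec_scalar_prod[OF col_carrier z])
  qed
  then show ?thesis by auto
qed

text \<open>Supplies the condition on \<open>t0\<close>: complex squares could cancel, but the data
  are real and the sum is positive before it is embedded.\<close>

lemma sum_of_real_squares_nonzero:
  fixes h :: "'i \<Rightarrow> real"
  assumes "finite I" "i \<in> I" "h i \<noteq> 0"
  shows "(\<Sum>i\<in>I. complex_of_real ((h i)\<^sup>2)) \<noteq> 0"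
proof -
  have "(\<Sum>i\<in>I. (h i)\<^sup>2) > 0" using assms by (intro sum_pos2[of I i]) auto
  then have "complex_of_real (\<Sum>i\<in>I. (h i)\<^sup>2) \<noteq> 0" by (simp only: of_real_eq_0_iff)
  then show ?thesis unfolding of_real_sum .
qed

lemma centered_ml_degree_conj_diag:
  assumes "orthonormal_mat Q n" "i0 < n" "l i0 = 0" "j0 < n" "l j0 \<noteq> 0"
    and r: "2 * card {i. i < n \<and> l i \<noteq> 0} \<le> N + 1"
  shows "centered_ml_degree_le (conj_diag Q l) N"
proof -
  interpret orthonormal_mat Q n by fact
  have dim: "dim_row (conj_diag Q l) = n" by (rule carrier_matD(1)[OF conj_diag_carrier])
  have "AE z in Pi\<^sub>M {..<n} (\<lambda>_. lborel). \<forall>c\<in>col Q ` {..<n}. c \<bullet> Matrix.vec n z \<noteq> 0"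
    by (rule AE_scalar_prod_nonzero) (auto, metis col_nonzero)
  then show ?thesis unfolding centered_ml_degree_le_def dim
  proof eventually_elim
    case (elim z)
    define t where "t = (\<lambda>i. complex_of_real ((col Q i \<bullet> Matrix.vec n z)\<^sup>2))"
    have t: "(\<Sum>i | i \<in> {..<n} \<and> complex_of_real (l i) = 0. t i) \<noteq> 0"
      unfolding t_def using assms(2,3) elim by (intro sum_of_real_squares_nonzero[of _ i0]) auto
    have c: "{i \<in> {..<n}. complex_of_real (l i) \<noteq> 0} = {i. i < n \<and> l i \<noteq> 0}" by auto
    note cs = card_likelihood_solutions_same[of "{..<n}" i0 "\<lambda>i. complex_of_real (l i)" t j0, OF _ _ _ t, unfolded c]
    show ?case
      unfolding centered_ml_solutions_conj_diag[OF assms(1) vec_carrier] t_def[symmetric]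
      using cs assms by auto
  qed
qed

section \<open>Orthogonal families, pseudoinverses and the group design\<close>

text \<open>With the vectors as columns of \<open>A\<close>, the Gram matrix of \<open>A\<close> is
  diagonal with nonzero entries. Hence \<open>A\<close> has trivial kernel and its columns are
  independent.\<close>

lemma card_orthogonal_vectors_le:
  fixes S :: "real Matrix.vec set"
  assumes S: "finite S" "S \<subseteq> carrier_vec q" "0\<^sub>v q \<notin> S"
    and orth: "\<And>u v. u \<in> S \<Longrightarrow> v \<in> S \<Longrightarrow> u \<noteq> v \<Longrightarrow> u \<bullet> v = 0"
  shows "card S \<le> q"
proof -
  interpret vec_space "TYPE(real)" q .
  obtain xs where xs: "set xs = S" "distinct xs" using finite_distinct_list[OF S(1)] by blast
  define k where "k = length xs"
  define A where "A = mat_of_cols q xs"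
  have A: "A \<in> carrier_mat q k" unfolding A_def k_def by (rule mat_of_cols_carrier)
  have cA: "cols A = xs" unfolding A_def using xs(1) S(2) by (intro cols_mat_of_cols) auto
  have colA: "col A i = xs ! i" if "i < k" for i
    using that cA A by (metis carrier_matD(2) cols_nth)
  have xin: "xs ! i \<in> S" if "i < k" for i using that xs(1) k_def by auto
  have "\<not> lin_dep (set (cols A))"
  proof
    assume "lin_dep (set (cols A))"
    then obtain v where v: "v \<in> carrier_vec k" "v \<noteq> 0\<^sub>v k" "A *\<^sub>v v = 0\<^sub>v q"
      using lin_depE[OF A] cA xs(2) by metis
    have D: "transpose_mat A * A = diag_fun k (\<lambda>i. xs ! i \<bullet> xs ! i)"
    proof (rule eq_matI)
      fix i j assume "i < dim_row (diag_fun k (\<lambda>i. xs ! i \<bullet> xs ! i))" "j < dim_col (diag_fun k (\<lambda>i. xs ! i \<bullet> xs ! i))"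
      then have ij: "i < k" "j < k" by (auto simp: diag_fun_def)
      have "xs ! i \<noteq> xs ! j" if "i \<noteq> j"
        using that ij xs(2) k_def by (simp add: nth_eq_iff_index_eq)
      then show "(transpose_mat A * A) $$ (i, j) = diag_fun k (\<lambda>i. xs ! i \<bullet> xs ! i) $$ (i, j)"
        using ij A colA orth[OF xin xin] by (auto simp: diag_fun_def)
    qed (use A in \<open>auto simp: diag_fun_def\<close>)
    have "(transpose_mat A * A) *\<^sub>v v = transpose_mat A *\<^sub>v (A *\<^sub>v v)"
      using A v(1) by (intro assoc_mult_mat_vec[of _ k q _ k]) auto
    also have "\<dots> = 0\<^sub>v k" unfolding v(3) using A by (intro eq_vecI) auto
    finally have zero: "Matrix.vec k (\<lambda>i. (xs ! i \<bullet> xs ! i) * v $ i) = 0\<^sub>v k"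
      unfolding D diag_fun_mult_vec[OF v(1)] .
    have z: "(xs ! i \<bullet> xs ! i) * v $ i = 0" if "i < k" for i
      using arg_cong[OF zero, of "\<lambda>w. w $ i"] that by simp
    have "v = 0\<^sub>v k"
    proof (rule eq_vecI)
      fix i assume "i < dim_vec (0\<^sub>v k :: real Matrix.vec)"
      then have i: "i < k" by simp
      then have "xs ! i \<bullet> xs ! i \<noteq> 0"
        using xin[OF i] S(2,3) scalar_prod_self_eq_0[of "xs ! i" q] by auto
      with z[OF i] i show "v $ i = 0\<^sub>v k $ i" by simp
    qed (use v in simp)
    with v(2) show False by simp
  qed
  then have "card (set (cols A)) \<le> dim" using A S cA xs by (intro li_le_dim) auto
  then show ?thesis unfolding cA xs(1) dim_is_n .
qed

text \<open>The vectors \<open>transpose_mat A *\<^sub>v e i\<close> lie in dimension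
  \<open>q\<close>, are pairwise orthogonal, and have squared length \<open>l i \<noteq> 0\<close>.
  A kernel vector \<open>g\<close> of \<open>A\<close> is orthogonal to all of them and takes up one
  further dimension.\<close>

lemma card_nonzero_eigenvalues_le:
  fixes A :: "real mat"
  assumes A: "A \<in> carrier_mat m q" and I: "finite I"
    and e: "\<And>i. i \<in> I \<Longrightarrow> e i \<in> carrier_vec m"
    and orth: "\<And>i j. i \<in> I \<Longrightarrow> j \<in> I \<Longrightarrow> e i \<bullet> e j = (if i = j then 1 else 0)"
    and eig: "\<And>i. i \<in> I \<Longrightarrow> (A * transpose_mat A) *\<^sub>v e i = l i \<cdot>\<^sub>v e i"
    and nz: "\<And>i. i \<in> I \<Longrightarrow> l i \<noteq> 0"
  shows "card I \<le> q"
    and "g \<in> carrier_vec q \<Longrightarrow> g \<noteq> 0\<^sub>v q \<Longrightarrow> A *\<^sub>v g = 0\<^sub>v m \<Longrightarrow> card I + 1 \<le> q"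
proof -
  define f where "f i = transpose_mat A *\<^sub>v e i" for i
  have f: "f i \<in> carrier_vec q" if "i \<in> I" for i using A e[OF that] by (simp add: f_def)
  have ff: "f i \<bullet> f j = (if i = j then l i else 0)" if ij: "i \<in> I" "j \<in> I" for i j
  proof -
    have "f i \<bullet> f j = e i \<bullet> (A *\<^sub>v f j)"
      unfolding f_def[of i] by (rule transpose_vec_mult_scalar[OF A f[OF ij(2)] e[OF ij(1)]])
    also have "A *\<^sub>v f j = (A * transpose_mat A) *\<^sub>v e j"
      unfolding f_def using A e[OF ij(2)] by (intro assoc_mult_mat_vec[of _ m q _ m, symmetric]) auto
    also have "\<dots> = l j \<cdot>\<^sub>v e j" by (rule eig[OF ij(2)])
    also have "e i \<bullet> (l j \<cdot>\<^sub>v e j) = l j * (e i \<bullet> e j)"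
      by (rule scalar_prod_smult_distrib[OF e[OF ij(1)] e[OF ij(2)]])
    finally show ?thesis using orth[OF ij] by simp
  qed
  have "f i \<noteq> 0\<^sub>v q" if "i \<in> I" for i
    using ff[OF that that] nz[OF that] f[OF that] by auto
  then have f0: "0\<^sub>v q \<notin> f ` I" by (metis imageE)
  have inj: "inj_on f I"
    using ff nz by (intro inj_onI) (metis (no_types, lifting))
  have orth': "u \<bullet> v = 0" if uv: "u \<in> f ` I" "v \<in> f ` I" "u \<noteq> v" for u v
    using uv ff by auto
  have "card (f ` I) \<le> q"
    by (rule card_orthogonal_vectors_le) (use I f f0 orth' in auto)
  then show "card I \<le> q" using card_image[OF inj] by simp
  assume g: "g \<in> carrier_vec q" "g \<noteq> 0\<^sub>v q" "A *\<^sub>v g = 0\<^sub>v m"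
  have fg: "f i \<bullet> g = 0" if "i \<in> I" for i
    unfolding f_def transpose_vec_mult_scalar[OF A g(1) e[OF that]] g(3) using e[OF that] by simp
  have gf: "g \<bullet> f i = 0" if "i \<in> I" for i
    using fg[OF that] comm_scalar_prod[OF g(1) f[OF that]] by simp
  have gg: "g \<bullet> g \<noteq> 0" using g scalar_prod_self_eq_0[OF g(1)] by simp
  then have gn: "g \<notin> f ` I" using fg by auto
  have "card (insert g (f ` I)) \<le> q"
  proof (rule card_orthogonal_vectors_le)
    fix u v assume "u \<in> insert g (f ` I)" "v \<in> insert g (f ` I)" "u \<noteq> v"
    then show "u \<bullet> v = 0" using orth' fg gf by auto
  qed (use I f f0 g in auto)
  then show "card I + 1 \<le> q" using gn I card_image[OF inj] by simp
qed

section \<open>Pseudoinverses of matrices with full column rank\<close>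

lemma is_pseudoinverse_unique:
  assumes G: "is_pseudoinverse A G" and H: "is_pseudoinverse A H"
  shows "G = H"
proof -
  define n m where "n = dim_row A" and "m = dim_col A"
  have A: "A \<in> carrier_mat n m" by (auto simp: n_def m_def)
  have Gc: "G \<in> carrier_mat m n" and Hc: "H \<in> carrier_mat m n"
    using G H by (auto simp: is_pseudoinverse_def n_def m_def)
  note g = G[unfolded is_pseudoinverse_def] and h = H[unfolded is_pseudoinverse_def]
  have AG: "A * G \<in> carrier_mat n n" "A * H \<in> carrier_mat n n"
    and GA: "G * A \<in> carrier_mat m m" "H * A \<in> carrier_mat m m" using A Gc Hc by auto
  \<comment> \<open>Both \<open>A * G\<close> and \<open>A * H\<close> are the symmetric projection
    onto the column space of \<open>A\<close>: absorbing one into the other and transposing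
    identifies them. The products in the other order are treated alike, and then G = G A G = H A H =
    H.\<close>
  have "A * G = (A * H * A) * G" using h by simp
  also have "\<dots> = (A * H) * (A * G)" using assoc_mult_mat[OF AG(2) A Gc] .
  finally have "transpose_mat (A * G) = transpose_mat (A * G) * transpose_mat (A * H)"
    using transpose_mult[OF AG(2,1)] by simp
  then have "A * G = (A * G) * (A * H)" using g h by simp
  also have "\<dots> = (A * G * A) * H" using assoc_mult_mat[OF AG(1) A Hc] by simp
  finally have 1: "A * G = A * H" using g by simp
  have "G * A = G * (A * H * A)" using h by simp
  also have "\<dots> = (G * A) * (H * A)"
    using assoc_mult_mat[OF A Hc A] assoc_mult_mat[OF Gc A GA(2)] by simp
  finally have "transpose_mat (G * A) = transpose_mat (H * A) * transpose_mat (G * A)"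
    using transpose_mult[OF GA(1,2)] by simp
  then have "G * A = (H * A) * (G * A)" using g h by simp
  also have "\<dots> = H * (A * G * A)"
    using assoc_mult_mat[OF Hc A GA(1)] assoc_mult_mat[OF A Gc A] by simp
  finally have 2: "G * A = H * A" using g by simp
  have "G = G * A * G" using g by simp
  also have "\<dots> = H * A * H"
    unfolding 2 using 1 assoc_mult_mat[OF Hc A Gc] assoc_mult_mat[OF Hc A Hc] by simp
  finally show ?thesis using h by simp
qed

text \<open>The rank is the size of a maximal independent set of columns. Rank \<open>p\<close>
  therefore forces the \<open>p\<close> columns to be distinct, and only then does independence of
  their set exclude a nontrivial relation between them.\<close>

lemma full_rank_injective:
  fixes X :: "real mat"
  assumes X: "X \<in> carrier_mat n p" and r: "vec_space.rank n X = p"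
    and v: "v \<in> carrier_vec p" "X *\<^sub>v v = 0\<^sub>v n"
  shows "v = 0\<^sub>v p"
proof (rule ccontr)
  assume v0: "v \<noteq> 0\<^sub>v p"
  interpret vec_space "TYPE(real)" n .
  obtain S where S: "maximal S (\<lambda>T. T \<subseteq> set (cols X) \<and> lin_indpt T)"
    using maximal_exists_superset[of "set (cols X)" "\<lambda>T. T \<subseteq> set (cols X) \<and> lin_indpt T" "{}"]
    by (auto simp: finite_lin_indpt2)
  have "p = card S" using rank_card_indpt[OF X S] r by simp
  also have "\<dots> \<le> card (set (cols X))" using S by (intro card_mono) (auto simp: maximal_def)
  finally have "card (set (cols X)) = length (cols X)"
    using card_length[of "cols X"] X by simp
  then have d: "distinct (cols X)" by (rule card_distinct)
  from full_rank_lin_indpt[OF X r d] lin_depI[OF X v(1) v0 v(2) d] show False by simp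
qed

text \<open>The normal matrix X'X is invertible, since X'X v = 0 gives Xv a zero length. With its
  inverse \<open>K\<close>, the matrix K X' satisfies the Penrose conditions and is the
  pseudoinverse by uniqueness.\<close>

lemma pseudoinverse_left_inverse:
  fixes X :: "real mat"
  assumes X: "X \<in> carrier_mat n p"
    and inj: "\<And>v. v \<in> carrier_vec p \<Longrightarrow> X *\<^sub>v v = 0\<^sub>v n \<Longrightarrow> v = 0\<^sub>v p"
  shows "is_pseudoinverse X (pseudoinverse X)" and "pseudoinverse X * X = 1\<^sub>m p"
proof -
  let ?T = "transpose_mat X"
  have T: "?T \<in> carrier_mat p n" using X by simp
  have TX: "?T * X \<in> carrier_mat p p" using X by simp
  have "det (?T * X) \<noteq> 0"
  proof
    assume "det (?T * X) = 0"
    then obtain v where v: "v \<in> carrier_vec p" "v \<noteq> 0\<^sub>v p" "(?T * X) *\<^sub>v v = 0\<^sub>v p"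
      using det_0_iff_vec_prod_zero[OF TX] by auto
    have Xv: "X *\<^sub>v v \<in> carrier_vec n" using X v by simp
    have "0 = v \<bullet> (?T *\<^sub>v (X *\<^sub>v v))"
      using v assoc_mult_mat_vec[OF T X v(1)] by simp
    also have "\<dots> = (X *\<^sub>v v) \<bullet> (X *\<^sub>v v)"
      using transpose_vec_mult_scalar[OF T Xv v(1)] by simp
    finally have "X *\<^sub>v v = 0\<^sub>v n" using scalar_prod_self_eq_0[OF Xv] by simp
    with inj v show False by blast
  qed
  from det_non_zero_imp_unit[OF TX this, of "()"] obtain K where
    K: "K \<in> carrier_mat p p" "K * (?T * X) = 1\<^sub>m p" "(?T * X) * K = 1\<^sub>m p"
    unfolding Units_def ring_mat_def by auto
  define G where "G = K * ?T"
  have G: "G \<in> carrier_mat p n" using K X by (simp add: G_def)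
  have GX: "G * X = 1\<^sub>m p" unfolding G_def using assoc_mult_mat[OF K(1) T X] K(2) by simp
  have tTX: "transpose_mat (?T * X) = ?T * X" using transpose_mult[OF T X] by simp
  have "transpose_mat K = transpose_mat K * ((?T * X) * K)" unfolding K(3) using K(1) by simp
  also have "\<dots> = (transpose_mat K * (?T * X)) * K"
    using K(1) TX by (intro assoc_mult_mat[symmetric, of _ p p _ p _ p]) auto
  also have "transpose_mat K * (?T * X) = transpose_mat ((?T * X) * K)"
    using transpose_mult[OF TX K(1)] tTX by simp
  finally have Ks: "transpose_mat K = K" unfolding K(3) using K(1) by simp
  have KT: "K * ?T \<in> carrier_mat p n" using K X by simp
  have "transpose_mat (X * G) = transpose_mat (K * ?T) * ?T"
    unfolding G_def by (rule transpose_mult[OF X KT])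
  also have "transpose_mat (K * ?T) = X * K"
    using transpose_mult[OF K(1) T] Ks by simp
  also have "X * K * ?T = X * G" unfolding G_def by (rule assoc_mult_mat[OF X K(1) T])
  finally have XGs: "transpose_mat (X * G) = X * G" .
  have "X * G * X = X" using assoc_mult_mat[OF X G X] GX X by simp
  moreover have "G * X * G = G" using GX G by simp
  ultimately have "is_pseudoinverse X G"
    unfolding is_pseudoinverse_def using G X XGs GX by auto
  then have e: "pseudoinverse X = G"
    unfolding pseudoinverse_def using is_pseudoinverse_unique by blast
  show "is_pseudoinverse X (pseudoinverse X)" unfolding e by fact
  show "pseudoinverse X * X = 1\<^sub>m p" unfolding e by fact
qed

lemma residual_projection_facts:
  fixes X :: "real mat"
  assumes X: "X \<in> carrier_mat n p" and G: "is_pseudoinverse X (pseudoinverse X)"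
  defines "M \<equiv> 1\<^sub>m n - X * pseudoinverse X"
  shows "M \<in> carrier_mat n n" "transpose_mat M = M" "M * X = 0\<^sub>m n p" "M * M = M"
    and "\<And>v. v \<in> carrier_vec n \<Longrightarrow> v = M *\<^sub>v v + X *\<^sub>v (pseudoinverse X *\<^sub>v v)"
proof -
  let ?G = "pseudoinverse X"
  note g = G[unfolded is_pseudoinverse_def]
  have Gc: "?G \<in> carrier_mat p n" using g X by auto
  have XG: "X * ?G \<in> carrier_mat n n" using X Gc by simp
  show M: "M \<in> carrier_mat n n" unfolding M_def by (rule minus_carrier_mat[OF XG])
  show "transpose_mat M = M"
    unfolding M_def transpose_minus[OF one_carrier_mat XG] using g by simp
  show MX: "M * X = 0\<^sub>m n p"
    unfolding M_def minus_mult_distrib_mat[OF one_carrier_mat XG X] using g X by simp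
  have "M * M = M * 1\<^sub>m n - M * (X * ?G)"
    unfolding M_def by (rule mult_minus_distrib_mat[OF minus_carrier_mat[OF XG] one_carrier_mat XG])
  also have "M * (X * ?G) = M * X * ?G" by (rule assoc_mult_mat[OF M X Gc, symmetric])
  also have "\<dots> = 0\<^sub>m n n" unfolding MX using Gc by simp
  also have "M * 1\<^sub>m n - 0\<^sub>m n n = M" using M by (intro eq_matI) auto
  finally show "M * M = M" .
  fix v :: "real Matrix.vec" assume v: "v \<in> carrier_vec n"
  have "M *\<^sub>v v = v - (X * ?G) *\<^sub>v v"
    unfolding M_def using minus_mult_distrib_mat_vec[OF one_carrier_mat XG v] v by simp
  also have "(X * ?G) *\<^sub>v v = X *\<^sub>v (?G *\<^sub>v v)" by (rule assoc_mult_mat_vec[OF X Gc v])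
  finally show "v = M *\<^sub>v v + X *\<^sub>v (?G *\<^sub>v v)"
    using v X Gc by (intro eq_vecI) auto
qed

section \<open>The group design matrix\<close>

lemma group_design_carrier: "group_design ns \<in> carrier_mat (sum_list ns) (length ns)"
proof -
  have "map (\<lambda>k. dim_row (mat_of_cols k [ones_vec k])) ns = ns"
    by (induction ns) auto
  then show ?thesis unfolding group_design_def
    by (intro carrier_matI) (auto simp: dim_diag_block_mat comp_def sum_list_triv)
qed

text \<open>Each observation belongs to exactly one group, so every row sum is 1. Once the all-ones
  vector lies in the column space of \<open>X\<close>, this makes \<open>ones_vec q\<close> a kernel
  vector of \<open>M * Z\<close>.\<close>

lemma group_design_mult_ones: "group_design ns *\<^sub>v ones_vec (length ns) = ones_vec (sum_list ns)"
proof (induction ns)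
  case Nil
  then show ?case by (intro eq_vecI) (auto simp: group_design_def ones_vec_def)
next
  case (Cons k ns)
  let ?A = "mat_of_cols k [ones_vec k]" and ?B = "group_design ns"
  have A: "?A \<in> carrier_mat k 1" using mat_of_cols_carrier(1)[of k "[ones_vec k]"] by simp
  note B = group_design_carrier[of ns]
  have app: "ones_vec (a + b) = ones_vec a @\<^sub>v ones_vec b" for a b
    by (intro eq_vecI) (auto simp: ones_vec_def)
  have "group_design (k # ns) = four_block_mat ?A (0\<^sub>m k (length ns)) (0\<^sub>m (sum_list ns) 1) ?B"
    using A B unfolding group_design_def by (simp add: Let_def)
  then have "group_design (k # ns) *\<^sub>v ones_vec (length (k # ns))
    = four_block_mat ?A (0\<^sub>m k (length ns)) (0\<^sub>m (sum_list ns) 1) ?B *\<^sub>v (ones_vec 1 @\<^sub>v ones_vec (length ns))"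
    using app[of 1 "length ns"] by simp
  also have "\<dots> = (?A *\<^sub>v ones_vec 1 + 0\<^sub>m k (length ns) *\<^sub>v ones_vec (length ns)) @\<^sub>v
      (0\<^sub>m (sum_list ns) 1 *\<^sub>v ones_vec 1 + ?B *\<^sub>v ones_vec (length ns))"
    by (rule four_block_mat_mult_vec[OF A _ _ B]) (auto simp: ones_vec_def)
  also have "0\<^sub>m (sum_list ns) 1 *\<^sub>v ones_vec 1 + ?B *\<^sub>v ones_vec (length ns) = ones_vec (sum_list ns)"
    unfolding Cons by (intro eq_vecI) (auto simp: ones_vec_def)
  also have "?A *\<^sub>v ones_vec 1 + 0\<^sub>m k (length ns) *\<^sub>v ones_vec (length ns) = ones_vec k"
    by (intro eq_vecI) (auto simp: ones_vec_def scalar_prod_def mat_of_cols_def)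
  finally show ?case using app[of k "sum_list ns"] by simp
qed

section \<open>Eigenbases adapted to a residual projection\<close>

context orthonormal_mat
begin

lemma conj_diag_symmetric: "transpose_mat (conj_diag Q f) = conj_diag Q f"
proof -
  let ?T = "transpose_mat Q" and ?D = "diag_fun n f"
  have D: "transpose_mat ?D = ?D" by (rule eq_matI) (auto simp: diag_fun_def)
  have "transpose_mat (conj_diag Q f) = Q * transpose_mat (Q * ?D)"
    unfolding conj_diag_def dims
    using transpose_mult[OF mult_carrier_mat[OF Q diag_fun_carrier] dims(3)] by simp
  also have "\<dots> = Q * (?D * ?T)" unfolding transpose_mult[OF Q diag_fun_carrier] D ..
  also have "\<dots> = conj_diag Q f"
    unfolding conj_diag_def dims by (rule assoc_mult_mat[OF Q diag_fun_carrier dims(3), symmetric])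
  finally show ?thesis .
qed

lemma conj_diag_eigenvector:
  assumes "i < n" shows "conj_diag Q f *\<^sub>v col Q i = f i \<cdot>\<^sub>v col Q i"
proof (rule eq_vec_by_coords)
  fix k assume k: "k < n"
  show "col Q k \<bullet> (conj_diag Q f *\<^sub>v col Q i) = col Q k \<bullet> (f i \<cdot>\<^sub>v col Q i)"
    unfolding conj_diag_coord[OF col_carrier k] scalar_prod_smult_distrib[OF col_carrier col_carrier]
      col_orthonormal[OF k assms] by simp
qed (use mult_mat_vec_carrier[OF conj_diag_carrier] in auto)

lemma conj_diag_eq_0:
  assumes "\<And>i. i < n \<Longrightarrow> f i = 0" shows "conj_diag Q f = 0\<^sub>m n n"
proof (rule mat_eq_by_mult_vec[of _ n n])
  fix v :: "'a Matrix.vec" assume v: "v \<in> carrier_vec n"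
  have z: "0\<^sub>m n n *\<^sub>v v = 0\<^sub>v n" using v by (intro eq_vecI) auto
  show "conj_diag Q f *\<^sub>v v = 0\<^sub>m n n *\<^sub>v v" unfolding z
  proof (rule eq_vec_by_coords)
    fix i assume i: "i < n"
    show "col Q i \<bullet> (conj_diag Q f *\<^sub>v v) = col Q i \<bullet> 0\<^sub>v n"
      unfolding conj_diag_coord[OF v i] assms[OF i] using scalar_prod_right_zero[OF col_carrier] by simp
  qed (use v mult_mat_vec_carrier[OF conj_diag_carrier] in auto)
qed auto

lemma coords_of_combination:
  assumes "i < n"
  shows "col Q i \<bullet> (Q *\<^sub>v Matrix.vec n c) = c i"
proof -
  have "(transpose_mat Q *\<^sub>v (Q *\<^sub>v Matrix.vec n c)) = (transpose_mat Q * Q) *\<^sub>v Matrix.vec n c"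
    by (rule assoc_mult_mat_vec[OF dims(3) Q vec_carrier, symmetric])
  also have "\<dots> = Matrix.vec n c" unfolding left by simp
  finally have "(transpose_mat Q *\<^sub>v (Q *\<^sub>v Matrix.vec n c)) $ i = c i" using assms by simp
  then show ?thesis unfolding transpose_mult_vec[OF assms] .
qed

end

text \<open>The columns of \<open>Q\<close> indexed by \<open>K\<close> span the range of the projection \<open>M\<close>, in which they
  diagonalize the compression of \<open>V\<close>; the remaining columns span the kernel of \<open>M\<close>.\<close>

locale residual_eigenbasis = orthonormal_mat Q n for Q :: "'a :: field mat" and n +
  fixes M V :: "'a mat" and K :: "nat set" and l :: "nat \<Rightarrow> 'a"
  assumes M: "M \<in> carrier_mat n n" "transpose_mat M = M"
    and V: "V \<in> carrier_mat n n" "transpose_mat V = V"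
    and K: "K \<subseteq> {..<n}"
    and inside: "\<And>i. i \<in> K \<Longrightarrow> M *\<^sub>v col Q i = col Q i"
    and eigen: "\<And>i. i \<in> K \<Longrightarrow> (M * V * M) *\<^sub>v col Q i = l i \<cdot>\<^sub>v col Q i"
    and outside: "\<And>i. i < n \<Longrightarrow> i \<notin> K \<Longrightarrow> M *\<^sub>v col Q i = 0\<^sub>v n"
begin

lemma finite_K: "finite K" using K finite_subset by blast

lemma coord_projection:
  assumes v: "v \<in> carrier_vec n" and i: "i < n"
  shows "col Q i \<bullet> (M *\<^sub>v v) = (if i \<in> K then col Q i \<bullet> v else 0)"
  using symmetric_bilinear[OF M col_carrier v, of i] inside[of i] outside[OF i] v by auto

lemma coord_outside:
  assumes "w \<in> carrier_vec n" "M *\<^sub>v w = w" "i < n" "i \<notin> K"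
  shows "col Q i \<bullet> w = 0"
  using coord_projection[of w i] assms by simp

text \<open>The range of \<open>M\<close> need not be invariant under \<open>V\<close>, but a
  coordinate along a column indexed by \<open>K\<close> ignores the part of
  \<open>V *\<^sub>v w\<close> outside that range, so only the compression acts.\<close>

lemma coord_inside:
  assumes w: "w \<in> carrier_vec n" "M *\<^sub>v w = w" and i: "i \<in> K"
  shows "col Q i \<bullet> (V *\<^sub>v w) = l i * (col Q i \<bullet> w)"
proof -
  have Vw: "V *\<^sub>v w \<in> carrier_vec n" by (rule mult_mat_vec_carrier[OF V(1) w(1)])
  have i': "i < n" using i K by auto
  have MVM: "M * V * M \<in> carrier_mat n n" using M V by simp
  have MVMs: "transpose_mat (M * V * M) = M * V * M"
    unfolding transpose_mult[OF mult_carrier_mat[OF M(1) V(1)] M(1)] transpose_mult[OF M(1) V(1)] M(2) V(2)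
    by (rule assoc_mult_mat[OF M(1) V(1) M(1), symmetric])
  have "col Q i \<bullet> (V *\<^sub>v w) = col Q i \<bullet> (M *\<^sub>v (V *\<^sub>v w))"
    using coord_projection[OF Vw i'] i by simp
  also have "M *\<^sub>v (V *\<^sub>v w) = (M * V) *\<^sub>v w"
    by (rule assoc_mult_mat_vec[OF M(1) V(1) w(1), symmetric])
  also have "\<dots> = (M * V) *\<^sub>v (M *\<^sub>v w)" using w(2) by simp
  also have "\<dots> = (M * V * M) *\<^sub>v w"
    by (rule assoc_mult_mat_vec[OF mult_carrier_mat[OF M(1) V(1)] M(1) w(1), symmetric])
  also have "col Q i \<bullet> \<dots> = ((M * V * M) *\<^sub>v col Q i) \<bullet> w"
    by (rule symmetric_bilinear[OF MVM MVMs col_carrier w(1)])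
  also have "\<dots> = l i * (col Q i \<bullet> w)"
    unfolding eigen[OF i] by (rule smult_scalar_prod_distrib[OF col_carrier w(1)])
  finally show ?thesis .
qed

text \<open>The coordinates of \<open>w\<close> outside \<open>K\<close> vanish. They also suppress
  the outside coordinates of \<open>V *\<^sub>v w\<close> in the Parseval sum, so both forms depend
  on the compression alone.\<close>

lemma residual_norm:
  assumes w: "w \<in> carrier_vec n" "M *\<^sub>v w = w"
  shows "w \<bullet> w = (\<Sum>i\<in>K. (col Q i \<bullet> w)\<^sup>2)"
    and "w \<bullet> (V *\<^sub>v w) = (\<Sum>i\<in>K. l i * (col Q i \<bullet> w)\<^sup>2)"
proof -
  have restrict: "(\<Sum>i<n. (col Q i \<bullet> w) * h i) = (\<Sum>i\<in>K. (col Q i \<bullet> w) * h i)" for h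
    using K coord_outside[OF w] by (intro sum.mono_neutral_right) auto
  show "w \<bullet> w = (\<Sum>i\<in>K. (col Q i \<bullet> w)\<^sup>2)"
    unfolding parseval[OF w(1) w(1)] restrict by (simp add: power2_eq_square)
  show "w \<bullet> (V *\<^sub>v w) = (\<Sum>i\<in>K. l i * (col Q i \<bullet> w)\<^sup>2)"
    unfolding parseval[OF w(1) mult_mat_vec_carrier[OF V(1) w(1)]] restrict
    by (intro sum.cong) (simp_all add: coord_inside[OF w] power2_eq_square)
qed

end

text \<open>Diagonalizing N = M V M alone would mix the kernel of \<open>M\<close> with the zero
  eigenvectors inside its range. Adding \<open>M\<close> separates them: as N is positive
  semidefinite, N + M has eigenvalues 1 + \<lambda> \<ge> 1 on the range of \<open>M\<close> and 0
  on its kernel. This is the origin of the index set \<open>c i \<noteq> 0\<close> and of the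
  eigenvalues \<open>c i - 1\<close>.\<close>

lemma residual_eigenbasis_exists:
  fixes M Z :: "real mat"
  assumes M: "M \<in> carrier_mat n n" "transpose_mat M = M" "M * M = M"
    and Z: "Z \<in> carrier_mat n q"
  obtains Q K l where "residual_eigenbasis Q n M (Z * transpose_mat Z) K l"
proof -
  let ?V = "Z * transpose_mat Z" and ?A = "M * Z"
  define N where "N = M * ?V * M"
  have V: "?V \<in> carrier_mat n n" using Z by simp
  have Vs: "transpose_mat ?V = ?V" using transpose_mult[OF Z, of "transpose_mat Z" n] Z by simp
  have MV: "M * ?V \<in> carrier_mat n n" using M V by simp
  have N: "N \<in> carrier_mat n n" unfolding N_def using MV M by simp
  have Ns: "transpose_mat N = N"
    unfolding N_def transpose_mult[OF MV M(1)] transpose_mult[OF M(1) V] M(2) Vs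
    by (rule assoc_mult_mat[OF M(1) V M(1), symmetric])
  have T: "N + M \<in> carrier_mat n n" using N M by simp
  have "transpose_mat (N + M) = N + M" using transpose_add[OF N M(1)] Ns M(2) by simp
  from symmetric_conj_diag[OF T this] obtain Q c where
    Q: "orthonormal_mat Q n" and Tc: "N + M = conj_diag Q c" by blast
  interpret orthonormal_mat Q n by fact
  have MN: "M * N = N"
    unfolding N_def using assoc_mult_mat[OF M(1) MV M(1)] assoc_mult_mat[OF M(1) M(1) V] M(3) by simp
  have Te: "N *\<^sub>v col Q i + M *\<^sub>v col Q i = c i \<cdot>\<^sub>v col Q i" if "i < n" for i
    using conj_diag_eigenvector[OF that, of c] add_mult_distrib_mat_vec[OF N M(1) col_carrier[of i]]
    unfolding Tc by simp
  have pos: "v \<bullet> (N *\<^sub>v v) \<ge> 0" if v: "v \<in> carrier_vec n" for v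
  proof -
    have Mv: "M *\<^sub>v v \<in> carrier_vec n" using M v by simp
    have Zv: "transpose_mat Z *\<^sub>v (M *\<^sub>v v) \<in> carrier_vec q"
      by (rule mult_mat_vec_carrier[OF _ Mv]) (use Z in simp)
    have "v \<bullet> (N *\<^sub>v v) = v \<bullet> (M *\<^sub>v (?V *\<^sub>v (M *\<^sub>v v)))"
      unfolding N_def using assoc_mult_mat_vec[OF MV M(1) v] assoc_mult_mat_vec[OF M(1) V Mv] by simp
    also have "\<dots> = (M *\<^sub>v v) \<bullet> (?V *\<^sub>v (M *\<^sub>v v))"
      by (rule symmetric_bilinear[OF M(1,2) v mult_mat_vec_carrier[OF V Mv]])
    also have "?V *\<^sub>v (M *\<^sub>v v) = Z *\<^sub>v (transpose_mat Z *\<^sub>v (M *\<^sub>v v))"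
      using Z by (intro assoc_mult_mat_vec[OF Z _ Mv]) auto
    also have "(M *\<^sub>v v) \<bullet> \<dots> = (transpose_mat Z *\<^sub>v (M *\<^sub>v v)) \<bullet> (transpose_mat Z *\<^sub>v (M *\<^sub>v v))"
      by (rule transpose_vec_mult_scalar[OF Z Zv Mv, symmetric])
    finally show ?thesis using scalar_prod_self_nonneg by simp
  qed
  have "residual_eigenbasis Q n M ?V {i. i < n \<and> c i \<noteq> 0} (\<lambda>i. c i - 1)"
  proof (unfold_locales; (fold N_def)?)
    fix i assume i: "i \<in> {i. i < n \<and> c i \<noteq> 0}"
    have e: "col Q i \<in> carrier_vec n" by simp
    have Ne: "N *\<^sub>v col Q i \<in> carrier_vec n" and Me: "M *\<^sub>v col Q i \<in> carrier_vec n"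
      using mult_mat_vec_carrier[OF N e] mult_mat_vec_carrier[OF M(1) e] .
    \<comment> \<open>Both M N = N and M M = M, so \<open>M\<close> fixes (N + M) e = c e; dividing
      by the nonzero c shows that \<open>M\<close> fixes e.\<close>
    have "c i \<cdot>\<^sub>v (M *\<^sub>v col Q i) = M *\<^sub>v (c i \<cdot>\<^sub>v col Q i)"
      using mult_mat_vec[OF M(1) e] by simp
    also have "\<dots> = M *\<^sub>v (N *\<^sub>v col Q i) + M *\<^sub>v (M *\<^sub>v col Q i)"
      using mult_add_distrib_mat_vec[OF M(1) Ne Me] Te i by simp
    also have "\<dots> = c i \<cdot>\<^sub>v col Q i"
      using assoc_mult_mat_vec[OF M(1) N e] assoc_mult_mat_vec[OF M(1) M(1) e] Te i by (simp add: MN M(3))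
    finally have sm: "c i \<cdot>\<^sub>v (M *\<^sub>v col Q i) = c i \<cdot>\<^sub>v col Q i" .
    show ins: "M *\<^sub>v col Q i = col Q i"
    proof (rule eq_vecI)
      fix k assume k: "k < dim_vec (col Q i)"
      have "(c i \<cdot>\<^sub>v (M *\<^sub>v col Q i)) $ k = (c i \<cdot>\<^sub>v col Q i) $ k" unfolding sm ..
      then show "(M *\<^sub>v col Q i) $ k = col Q i $ k" using i k Me M(1) by simp
    qed (use M in simp)
    show "N *\<^sub>v col Q i = (c i - 1) \<cdot>\<^sub>v col Q i"
    proof (rule eq_vecI)
      fix k assume k: "k < dim_vec ((c i - 1) \<cdot>\<^sub>v col Q i)"
      have "(N *\<^sub>v col Q i + M *\<^sub>v col Q i) $ k = (c i \<cdot>\<^sub>v col Q i) $ k" using Te i by simp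
      then show "(N *\<^sub>v col Q i) $ k = ((c i - 1) \<cdot>\<^sub>v col Q i) $ k"
        unfolding ins using k Ne N by (simp add: left_diff_distrib)
    qed (use N in simp)
  next
    fix i assume i: "i < n" "i \<notin> {i. i < n \<and> c i \<noteq> 0}"
    have e: "col Q i \<in> carrier_vec n" by simp
    have Ne: "N *\<^sub>v col Q i \<in> carrier_vec n" and Me: "M *\<^sub>v col Q i \<in> carrier_vec n"
      using mult_mat_vec_carrier[OF N e] mult_mat_vec_carrier[OF M(1) e] .
    \<comment> \<open>For eigenvalue 0, the two nonnegative numbers e'Ne and e'Me = |Me|^2 add up to
      0, hence Me = 0.\<close>
    have "col Q i \<bullet> (N *\<^sub>v col Q i) + col Q i \<bullet> (M *\<^sub>v col Q i) = col Q i \<bullet> (c i \<cdot>\<^sub>v col Q i)"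
      using scalar_prod_add_distrib[OF e Ne Me] Te i by simp
    also have "\<dots> = 0" using i scalar_prod_smult_distrib[OF e e, of "c i"] by simp
    also have "col Q i \<bullet> (M *\<^sub>v col Q i) = (M *\<^sub>v col Q i) \<bullet> (M *\<^sub>v col Q i)"
      using symmetric_bilinear[OF M(1,2) e Me] assoc_mult_mat_vec[OF M(1) M(1) e] M(3) by simp
    finally have "(M *\<^sub>v col Q i) \<bullet> (M *\<^sub>v col Q i) = 0"
      using pos[OF e] scalar_prod_self_nonneg[of "M *\<^sub>v col Q i"] by linarith
    then show "M *\<^sub>v col Q i = 0\<^sub>v n" using scalar_prod_self_eq_0[OF Me] by simp
  qed (use M V Vs in auto)
  then show thesis by (rule that)
qed

text \<open>Existence rests on positivity and is a real fact; the defining identities, by contrast,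
  survive the embedding into the complex numbers.\<close>

lemma residual_eigenbasis_cmat:
  assumes "residual_eigenbasis Q n M V K l"
  shows "residual_eigenbasis (cmat Q) n (cmat M) (cmat V) K (\<lambda>i. complex_of_real (l i))"
proof -
  interpret residual_eigenbasis Q n M V K l by fact
  interpret c: orthonormal_mat "cmat Q" n by (rule orthonormal_mat_cmat) unfold_locales
  have cl: "col (cmat Q) i = cvec (col Q i)" if "i < n" for i using that by simp
  have MVM: "cmat M * cmat V * cmat M = cmat (M * V * M)"
    unfolding cmat_mult[OF mult_carrier_mat[OF M(1) V(1)] M(1)] cmat_mult[OF M(1) V(1)] ..
  show ?thesis
  proof (unfold_locales; (unfold MVM)?)
    fix i assume i: "i \<in> K"
    then have i': "i < n" using K by auto
    show "cmat M *\<^sub>v col (cmat Q) i = col (cmat Q) i"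
      unfolding cl[OF i'] cmat_mult_vec[OF M(1) col_carrier, symmetric] inside[OF i] ..
    have "M * V * M \<in> carrier_mat n n" using M V by simp
    from cmat_mult_vec[OF this col_carrier[of i]]
    show "cmat (M * V * M) *\<^sub>v col (cmat Q) i = complex_of_real (l i) \<cdot>\<^sub>v col (cmat Q) i"
      unfolding cl[OF i'] eigen[OF i] by (simp add: of_real_hom.vec_hom_smult)
  next
    fix i assume i: "i < n" "i \<notin> K"
    show "cmat M *\<^sub>v col (cmat Q) i = 0\<^sub>v n"
      unfolding cl[OF i(1)] cmat_mult_vec[OF M(1) col_carrier, symmetric] outside[OF i]
      by (rule of_real_hom.vec_hom_zero)
  qed (use M V K in \<open>auto simp: map_mat_transpose\<close>)
qed

section \<open>Column spaces and zero eigenvalues of the compression\<close>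

lemma append_columns_mult_vec:
  assumes A: "A \<in> carrier_mat n p" and B: "B \<in> carrier_mat n m"
    and a: "a \<in> carrier_vec p" and b: "b \<in> carrier_vec m"
  shows "append_columns A B *\<^sub>v (a @\<^sub>v b) = A *\<^sub>v a + (B :: real mat) *\<^sub>v b"
    and "append_columns A B \<in> carrier_mat n (p + m)"
proof -
  \<comment> \<open>Two blocks side by side are read as a 2 by 2 block matrix with lower blocks of
    zero rows, for which a product rule is available.\<close>
  have e: "append_columns A B = four_block_mat A B (0\<^sub>m 0 p) (0\<^sub>m 0 m)"
    using A B unfolding append_columns_def
    by (intro eq_matI) (auto simp: mat_of_cols_def nth_append)
  have "append_columns A B *\<^sub>v (a @\<^sub>v b) = (A *\<^sub>v a + B *\<^sub>v b) @\<^sub>v (0\<^sub>m 0 p *\<^sub>v a + 0\<^sub>m 0 m *\<^sub>v b)"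
    unfolding e by (rule four_block_mat_mult_vec[OF A B _ _ a b]) auto
  also have "\<dots> = A *\<^sub>v a + B *\<^sub>v b" by (intro eq_vecI) auto
  finally show "append_columns A B *\<^sub>v (a @\<^sub>v b) = A *\<^sub>v a + B *\<^sub>v b" .
  show "append_columns A B \<in> carrier_mat n (p + m)"
    unfolding e using four_block_carrier_mat[OF A, of "0\<^sub>m 0 m" 0 m B "0\<^sub>m 0 p"] by simp
qed

lemma mem_column_space_iff:
  assumes A: "A \<in> carrier_mat n m"
  shows "v \<in> column_space A \<longleftrightarrow> (\<exists>x\<in>carrier_vec m. A *\<^sub>v x = v)"
proof -
  interpret vec_space "TYPE(real)" n .
  show ?thesis
    unfolding column_space_def using col_space_eq[OF A] A by auto
qed

text \<open>Without zero eigenvalues the compression is invertible on the range of \<open>M\<close>;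
  \<open>d\<close> is the preimage of \<open>M *\<^sub>v x\<close>, obtained by dividing its
  coordinates by \<open>l i\<close>.\<close>

lemma (in residual_eigenbasis) projection_in_image:
  assumes nz: "\<And>i. i \<in> K \<Longrightarrow> l i \<noteq> 0" and x: "x \<in> carrier_vec n"
  obtains d where "d \<in> carrier_vec n" "M *\<^sub>v x = M *\<^sub>v (V *\<^sub>v d)"
proof -
  define d where "d = Q *\<^sub>v Matrix.vec n (\<lambda>i. if i \<in> K then (col Q i \<bullet> x) / l i else 0)"
  have d: "d \<in> carrier_vec n" unfolding d_def by (rule mult_mat_vec_carrier[OF Q]) simp
  have cd: "col Q i \<bullet> d = (if i \<in> K then (col Q i \<bullet> x) / l i else 0)" if "i < n" for i
    unfolding d_def by (rule coords_of_combination[OF that])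
  have Md: "M *\<^sub>v d = d"
    by (rule eq_vec_by_coords) (use d mult_mat_vec_carrier[OF M(1) d] in \<open>auto simp: coord_projection cd\<close>)
  have Vd: "V *\<^sub>v d \<in> carrier_vec n" by (rule mult_mat_vec_carrier[OF V(1) d])
  have "M *\<^sub>v x = M *\<^sub>v (V *\<^sub>v d)"
  proof (rule eq_vec_by_coords)
    fix i assume i: "i < n"
    show "col Q i \<bullet> (M *\<^sub>v x) = col Q i \<bullet> (M *\<^sub>v (V *\<^sub>v d))"
      unfolding coord_projection[OF x i] coord_projection[OF Vd i]
      using coord_inside[OF d Md, of i] cd[OF i] nz[of i] by simp
  qed (use mult_mat_vec_carrier[OF M(1)] x Vd in auto)
  with d that show thesis by blast
qed

text \<open>Used in contrapositive form, to produce a zero eigenvalue from a proper column space.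
  With \<open>d\<close> chosen so that x - V d is annihilated by \<open>M\<close>, the decomposition
  leaves x - V d = X (G (x - V d)).\<close>

lemma column_space_append_eq_carrier:
  assumes b: "residual_eigenbasis Q n M V K l" and nz: "\<And>i. i \<in> K \<Longrightarrow> l i \<noteq> 0"
    and X: "X \<in> carrier_mat n p" and G: "G \<in> carrier_mat p n"
    and dec: "\<And>v. v \<in> carrier_vec n \<Longrightarrow> v = M *\<^sub>v v + X *\<^sub>v (G *\<^sub>v v)"
  shows "carrier_vec n \<subseteq> column_space (append_columns X V)"
proof
  interpret residual_eigenbasis Q n M V K l by fact
  fix x :: "real Matrix.vec" assume x: "x \<in> carrier_vec n"
  obtain d where d: "d \<in> carrier_vec n" and e: "M *\<^sub>v x = M *\<^sub>v (V *\<^sub>v d)"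
    using projection_in_image[OF nz x] by blast
  have Vd: "V *\<^sub>v d \<in> carrier_vec n" by (rule mult_mat_vec_carrier[OF V(1) d])
  define a where "a = G *\<^sub>v x - G *\<^sub>v (V *\<^sub>v d)"
  have Gx: "G *\<^sub>v x \<in> carrier_vec p" "G *\<^sub>v (V *\<^sub>v d) \<in> carrier_vec p"
    using mult_mat_vec_carrier[OF G] x Vd by auto
  have a: "a \<in> carrier_vec p" using Gx by (simp add: a_def)
  have "X *\<^sub>v a = X *\<^sub>v (G *\<^sub>v x) - X *\<^sub>v (G *\<^sub>v (V *\<^sub>v d))"
    unfolding a_def by (rule mult_minus_distrib_mat_vec[OF X Gx])
  moreover have "(M *\<^sub>v x) $ i + (X *\<^sub>v (G *\<^sub>v x)) $ i = x $ i" if "i < n" for i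
    using arg_cong[OF dec[OF x], of "\<lambda>u. u $ i"] that X M by simp
  moreover have "(M *\<^sub>v x) $ i + (X *\<^sub>v (G *\<^sub>v (V *\<^sub>v d))) $ i = (V *\<^sub>v d) $ i" if "i < n" for i
    using arg_cong[OF dec[OF Vd], of "\<lambda>u. u $ i"] that X M unfolding e by simp
  ultimately have "X *\<^sub>v a + V *\<^sub>v d = x"
    using X V x by (intro eq_vecI) (fastforce simp: algebra_simps)+
  then have "append_columns X V *\<^sub>v (a @\<^sub>v d) = x"
    using append_columns_mult_vec(1)[OF X V(1) a d] by simp
  then show "x \<in> column_space (append_columns X V)"
    using mem_column_space_iff[OF append_columns_mult_vec(2)[OF X V(1) a d]] a d by auto
qed

text \<open>Every solution is described by w, the inverse covariance applied to the residual. Its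
  coordinates are fixed by the variance components and the data, and \<beta> is recoverable from it,
  so the matrix equations reduce to scalar ones in \<open>a\<close> and \<open>b\<close>.\<close>

lemma ml_solution_coordinates:
  assumes basis: "residual_eigenbasis Q n M V K l"
    and P: "orthonormal_mat P n" and VP: "V = conj_diag P m"
    and X: "X \<in> carrier_mat n p" and G: "G \<in> carrier_mat p n"
    and MX: "M * X = 0\<^sub>m n p" and Mdef: "M = 1\<^sub>m n - X * G"
    and y: "y \<in> carrier_vec n" and generic: "\<And>i. i \<in> K \<Longrightarrow> col Q i \<bullet> y \<noteq> 0"
    and sol: "(\<beta>, (a, b)) \<in> ml_solutions X V y"
  obtains w where "w \<in> carrier_vec n" "cmat M *\<^sub>v w = w"
    and "\<And>i. i \<in> K \<Longrightarrow> col (cmat Q) i \<bullet> w = complex_of_real (col Q i \<bullet> y) / (a * complex_of_real (l i) + b)"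
    and "cmat X *\<^sub>v \<beta> = cvec y - covariance V (a, b) *\<^sub>v w"
    and "(a, b) \<in> likelihood_solutions K (\<lambda>i. complex_of_real (l i))
      (\<lambda>i. complex_of_real ((col Q i \<bullet> y)\<^sup>2)) {..<n} (\<lambda>j. complex_of_real (m j))"
proof -
  interpret real: residual_eigenbasis Q n M V K l by fact
  interpret residual_eigenbasis "cmat Q" n "cmat M" "cmat V" K "\<lambda>i. complex_of_real (l i)"
    by (rule residual_eigenbasis_cmat[OF basis])
  interpret p: orthonormal_mat "cmat P" n by (rule orthonormal_mat_cmat[OF P])
  let ?X = "cmat X" and ?V = "cmat V" and ?M = "cmat M"
  define \<mu> where "\<mu> = (\<lambda>j. complex_of_real (m j))"
  define \<nu> where "\<nu> = (\<lambda>i. complex_of_real (l i))"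
  define C where "C = covariance V (a, b)"
  have Cd: "C = conj_diag (cmat P) (\<lambda>j. a * \<mu> j + b)"
    unfolding C_def VP covariance_conj_diag[OF P] \<mu>_def ..
  have Vd: "?V = conj_diag (cmat P) \<mu>" unfolding VP cmat_conj_diag[OF P] \<mu>_def ..
  have C: "C \<in> carrier_mat n n" unfolding Cd by simp
  have \<beta>: "\<beta> \<in> carrier_vec p" using sol X by (auto simp: ml_solutions_def)
  have "invertible_mat C" using sol by (simp add: ml_solutions_def C_def)
  then have nzm: "a * \<mu> j + b \<noteq> 0" if "j < n" for j
    using that unfolding Cd p.invertible_conj_diag_iff by blast
  define S where "S = the (mat_inverse C)"
  define r where "r = cvec y - ?X *\<^sub>v \<beta>"
  define w where "w = S *\<^sub>v r"
  have Sd: "S = conj_diag (cmat P) (\<lambda>j. 1 / (a * \<mu> j + b))"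
    unfolding S_def Cd using nzm by (rule p.mat_inverse_conj_diag)
  have S: "S \<in> carrier_mat n n" unfolding Sd by simp
  have Ss: "transpose_mat S = S" unfolding Sd by (rule p.conj_diag_symmetric)
  have CS: "C * S = 1\<^sub>m n" unfolding Sd Cd using nzm by (rule p.conj_diag_inverse)
  have X': "?X \<in> carrier_mat n p" and V': "?V \<in> carrier_mat n n" using X V by auto
  have X\<beta>: "?X *\<^sub>v \<beta> \<in> carrier_vec n" by (rule mult_mat_vec_carrier[OF X' \<beta>])
  have r: "r \<in> carrier_vec n" using y X\<beta> by (simp add: r_def)
  have w: "w \<in> carrier_vec n" unfolding w_def by (rule mult_mat_vec_carrier[OF S r])
  have e1: "transpose_mat ?X *\<^sub>v w = 0\<^sub>v p"
    and e2: "mat_trace (S * ?V) = r \<bullet> ((S * ?V * S) *\<^sub>v r)"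
    and e3: "mat_trace S = r \<bullet> ((S * S) *\<^sub>v r)"
    using sol X unfolding ml_solutions_def Let_def w_def S_def r_def C_def by auto
  have rw: "C *\<^sub>v w = r"
    unfolding w_def assoc_mult_mat_vec[OF C S r, symmetric] CS using r by simp
  \<comment> \<open>By symmetry M = 1 - G'X', and the equation for \<beta> says X'w = 0.\<close>
  have Mw: "?M *\<^sub>v w = w"
  proof -
    have "transpose_mat M = 1\<^sub>m n - transpose_mat G * transpose_mat X"
      unfolding Mdef using transpose_minus[of "1\<^sub>m n" n n "X * G"] X G by (simp add: transpose_mult[OF X G])
    then have Mt: "M = 1\<^sub>m n - transpose_mat G * transpose_mat X" using real.M(2) by simp
    have GX: "cmat (transpose_mat G * transpose_mat X) = cmat (transpose_mat G) * transpose_mat ?X"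
      using cmat_mult[of "transpose_mat G" n p "transpose_mat X" n] X G by (simp add: map_mat_transpose)
    have "?M = 1\<^sub>m n - cmat (transpose_mat G) * transpose_mat ?X"
      unfolding GX[symmetric] by (subst Mt, rule eq_matI) (use X G in auto)
    moreover have "cmat (transpose_mat G) * transpose_mat ?X \<in> carrier_mat n n" using X G by auto
    ultimately have "?M *\<^sub>v w = w - (cmat (transpose_mat G) * transpose_mat ?X) *\<^sub>v w"
      using minus_mult_distrib_mat_vec[OF one_carrier_mat _ w] w by simp
    also have "(cmat (transpose_mat G) * transpose_mat ?X) *\<^sub>v w
        = cmat (transpose_mat G) *\<^sub>v (transpose_mat ?X *\<^sub>v w)"
      using X G by (intro assoc_mult_mat_vec[OF _ _ w]) auto
    also have "\<dots> = 0\<^sub>v n" unfolding e1 using G by (intro eq_vecI) auto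
    also have "w - 0\<^sub>v n = w" using w by simp
    finally show ?thesis .
  qed
  \<comment> \<open>Coordinate along a column in \<open>K\<close> of the identity "covariance times
    w equals y - X \<beta>": the term with \<beta> disappears since M X = 0, and \<open>V\<close>
    acts through the compression.\<close>
  have coord: "(a * \<nu> i + b) * (col (cmat Q) i \<bullet> w) = complex_of_real (col Q i \<bullet> y)" if i: "i \<in> K" for i
  proof -
    have i': "i < n" using i K by auto
    have Vw: "?V *\<^sub>v w \<in> carrier_vec n" by (rule mult_mat_vec_carrier[OF V' w])
    have "C = a \<cdot>\<^sub>m ?V + b \<cdot>\<^sub>m 1\<^sub>m n" unfolding C_def covariance_def using real.V by simp
    then have "C *\<^sub>v w = a \<cdot>\<^sub>v (?V *\<^sub>v w) + b \<cdot>\<^sub>v w"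
      using w V' by (simp add: add_mult_distrib_mat_vec[of _ n n] smult_mat_mult_vec[of _ n n])
    then have "col (cmat Q) i \<bullet> r = a * (col (cmat Q) i \<bullet> (?V *\<^sub>v w)) + b * (col (cmat Q) i \<bullet> w)"
      unfolding rw[symmetric] using w Vw
      by (simp add: scalar_prod_add_distrib[OF col_carrier] scalar_prod_smult_distrib[OF col_carrier])
    also have "\<dots> = (a * \<nu> i + b) * (col (cmat Q) i \<bullet> w)"
      unfolding coord_inside[OF w Mw i] \<nu>_def by (simp add: algebra_simps)
    finally have 1: "col (cmat Q) i \<bullet> r = (a * \<nu> i + b) * (col (cmat Q) i \<bullet> w)" .
    have "?M *\<^sub>v (?X *\<^sub>v \<beta>) = (?M * ?X) *\<^sub>v \<beta>"
      by (rule assoc_mult_mat_vec[OF M(1) X' \<beta>, symmetric])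
    also have "?M * ?X = 0\<^sub>m n p"
      unfolding cmat_mult[OF real.M(1) X, symmetric] MX by (rule eq_matI) auto
    also have "0\<^sub>m n p *\<^sub>v \<beta> = 0\<^sub>v n" using \<beta> by (intro eq_vecI) auto
    finally have "col (cmat Q) i \<bullet> (?X *\<^sub>v \<beta>) = 0"
      using coord_projection[OF X\<beta> i'] i scalar_prod_right_zero[OF col_carrier] by simp
    then have "col (cmat Q) i \<bullet> r = col (cmat Q) i \<bullet> cvec y"
      unfolding r_def using scalar_prod_minus_distrib[OF col_carrier _ X\<beta>, of "cvec y"] y by simp
    also have "\<dots> = complex_of_real (col Q i \<bullet> y)"
      using cvec_scalar_prod[OF real.col_carrier y, of i] i' by simp
    finally show ?thesis using 1 by simp
  qed
  \<comment> \<open>Invertibility of the covariance controls only \<open>a * \<mu> j + b\<close>.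
    For the eigenvalues of the compression the data must help: a vanishing factor would make the
    coordinate of \<open>y\<close> zero.\<close>
  have nzl: "a * \<nu> i + b \<noteq> 0" if "i \<in> K" for i using coord[OF that] generic[OF that] by auto
  have cw: "col (cmat Q) i \<bullet> w = complex_of_real (col Q i \<bullet> y) / (a * \<nu> i + b)" if "i \<in> K" for i
    using coord[OF that] nzl[OF that] by (simp add: field_simps)
  have quad: "r \<bullet> (S *\<^sub>v u) = w \<bullet> u" if "u \<in> carrier_vec n" for u
    unfolding w_def by (rule symmetric_bilinear[OF S Ss r that])
  have "r \<bullet> ((S * ?V * S) *\<^sub>v r) = r \<bullet> (S *\<^sub>v (?V *\<^sub>v w))"
    unfolding w_def using assoc_mult_mat_vec[OF mult_carrier_mat[OF S V'] S r]
      assoc_mult_mat_vec[OF S V' mult_mat_vec_carrier[OF S r]] by simp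
  also have "\<dots> = w \<bullet> (?V *\<^sub>v w)" by (rule quad[OF mult_mat_vec_carrier[OF V' w]])
  also have "\<dots> = (\<Sum>i\<in>K. \<nu> i * (complex_of_real (col Q i \<bullet> y) / (a * \<nu> i + b))\<^sup>2)"
    unfolding residual_norm[OF w Mw] \<nu>_def[symmetric] by (intro sum.cong) (simp_all add: cw \<nu>_def)
  finally have q2: "r \<bullet> ((S * ?V * S) *\<^sub>v r) = \<dots>" .
  have "r \<bullet> ((S * S) *\<^sub>v r) = r \<bullet> (S *\<^sub>v w)"
    unfolding w_def using assoc_mult_mat_vec[OF S S r] by simp
  also have "\<dots> = w \<bullet> w" by (rule quad[OF w])
  also have "\<dots> = (\<Sum>i\<in>K. (complex_of_real (col Q i \<bullet> y) / (a * \<nu> i + b))\<^sup>2)"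
    unfolding residual_norm[OF w Mw] by (intro sum.cong) (simp_all add: cw)
  finally have q3: "r \<bullet> ((S * S) *\<^sub>v r) = \<dots>" .
  have t2: "mat_trace (S * ?V) = (\<Sum>j<n. \<mu> j / (a * \<mu> j + b))"
    unfolding Sd Vd p.conj_diag_mult p.conj_diag_trace by simp
  have t3: "mat_trace S = (\<Sum>j<n. 1 / (a * \<mu> j + b))"
    unfolding Sd p.conj_diag_trace ..
  show thesis
  proof
    show "w \<in> carrier_vec n" "?M *\<^sub>v w = w" by fact+
    show "col (cmat Q) i \<bullet> w = complex_of_real (col Q i \<bullet> y) / (a * complex_of_real (l i) + b)" if "i \<in> K" for i
      using cw[OF that] by (simp add: \<nu>_def)
    show "?X *\<^sub>v \<beta> = cvec y - covariance V (a, b) *\<^sub>v w"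
      unfolding C_def[symmetric] rw r_def using y X\<beta> by (intro eq_vecI) auto
    show "(a, b) \<in> likelihood_solutions K (\<lambda>i. complex_of_real (l i))
      (\<lambda>i. complex_of_real ((col Q i \<bullet> y)\<^sup>2)) {..<n} (\<lambda>j. complex_of_real (m j))"
      unfolding \<nu>_def[symmetric] \<mu>_def[symmetric] likelihood_solutions_def
      using nzl nzm e2[unfolded q2 t2] e3[unfolded q3 t3] by (auto simp: power_divide)
  qed
qed

section \<open>Degree bounds\<close>

text \<open>Forgetting \<beta> loses nothing: the pair (a, b) fixes all coordinates of w, hence w,
  hence X \<beta>, and the left inverse \<open>G\<close> of \<open>X\<close> returns
  \<beta>.\<close>

lemma ml_solutions_count:
  assumes basis: "residual_eigenbasis Q n M V K l"
    and P: "orthonormal_mat P n" and VP: "V = conj_diag P m"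
    and X: "X \<in> carrier_mat n p" and G: "G \<in> carrier_mat p n" and GX: "G * X = 1\<^sub>m p"
    and MX: "M * X = 0\<^sub>m n p" and Mdef: "M = 1\<^sub>m n - X * G"
    and y: "y \<in> carrier_vec n" and generic: "\<And>i. i \<in> K \<Longrightarrow> col Q i \<bullet> y \<noteq> 0"
    and i0: "i0 \<in> K" "l i0 = 0" and j0: "j0 < n" "m j0 \<noteq> 0"
  shows "finite (ml_solutions X V y)"
    and "card (ml_solutions X V y) + 1 \<le> 2 * card {i \<in> K. l i \<noteq> 0} + card {j. j < n \<and> m j \<noteq> 0}"
proof -
  interpret real: residual_eigenbasis Q n M V K l by fact
  interpret residual_eigenbasis "cmat Q" n "cmat M" "cmat V" K "\<lambda>i. complex_of_real (l i)"
    by (rule residual_eigenbasis_cmat[OF basis])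
  let ?L = "likelihood_solutions K (\<lambda>i. complex_of_real (l i))
      (\<lambda>i. complex_of_real ((col Q i \<bullet> y)\<^sup>2)) {..<n} (\<lambda>j. complex_of_real (m j))"
  note coords = ml_solution_coordinates[OF basis P VP X G MX Mdef y generic]
  have sub: "snd ` ml_solutions X V y \<subseteq> ?L"
  proof
    fix s assume "s \<in> snd ` ml_solutions X V y"
    then obtain \<beta> a b where "s = (a, b)" "(\<beta>, (a, b)) \<in> ml_solutions X V y" by auto
    then show "s \<in> ?L" using coords by blast
  qed
  have inj: "inj_on snd (ml_solutions X V y)"
  proof (rule inj_onI, clarsimp)
    fix \<beta> \<beta>' a b assume s: "(\<beta>, (a, b)) \<in> ml_solutions X V y" "(\<beta>', (a, b)) \<in> ml_solutions X V y"
    obtain w where w: "w \<in> carrier_vec n" "cmat M *\<^sub>v w = w"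
      "\<And>i. i \<in> K \<Longrightarrow> col (cmat Q) i \<bullet> w = complex_of_real (col Q i \<bullet> y) / (a * complex_of_real (l i) + b)"
      "cmat X *\<^sub>v \<beta> = cvec y - covariance V (a, b) *\<^sub>v w"
      using coords[OF _ s(1)] by blast
    obtain w' where w': "w' \<in> carrier_vec n" "cmat M *\<^sub>v w' = w'"
      "\<And>i. i \<in> K \<Longrightarrow> col (cmat Q) i \<bullet> w' = complex_of_real (col Q i \<bullet> y) / (a * complex_of_real (l i) + b)"
      "cmat X *\<^sub>v \<beta>' = cvec y - covariance V (a, b) *\<^sub>v w'"
      using coords[OF _ s(2)] by blast
    have "w = w'"
      by (rule eq_vec_by_coords[OF w(1) w'(1)]) (metis w(3) w'(3) coord_outside[OF w(1,2)] coord_outside[OF w'(1,2)])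
    then have e: "cmat X *\<^sub>v \<beta> = cmat X *\<^sub>v \<beta>'" using w(4) w'(4) by simp
    have \<beta>: "\<beta> \<in> carrier_vec p" "\<beta>' \<in> carrier_vec p" using s X by (auto simp: ml_solutions_def)
    have "cmat G * cmat X = 1\<^sub>m p"
      unfolding cmat_mult[OF G X, symmetric] GX by (rule of_real_hom.mat_hom_one)
    then have "\<gamma> = cmat G *\<^sub>v (cmat X *\<^sub>v \<gamma>)" if "\<gamma> \<in> carrier_vec p" for \<gamma>
      using assoc_mult_mat_vec[of "cmat G" p n "cmat X" p \<gamma>] G X that by simp
    then show "\<beta> = \<beta>'" using e \<beta> by metis
  qed
  have t: "(\<Sum>i | i \<in> K \<and> complex_of_real (l i) = 0. complex_of_real ((col Q i \<bullet> y)\<^sup>2)) \<noteq> 0"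
    using i0 generic real.finite_K by (intro sum_of_real_squares_nonzero[of _ i0]) auto
  have c: "{i \<in> K. complex_of_real (l i) \<noteq> 0} = {i \<in> K. l i \<noteq> 0}"
    "{j \<in> {..<n}. complex_of_real (m j) \<noteq> 0} = {j. j < n \<and> m j \<noteq> 0}" by auto
  note L = card_likelihood_solutions[of K "{..<n}" i0 "\<lambda>i. complex_of_real (l i)" _ j0
      "\<lambda>j. complex_of_real (m j)", OF _ _ _ _ t, unfolded c]
  have Lf: "finite ?L" using L(1) i0 j0 real.finite_K by simp
  show "finite (ml_solutions X V y)"
    using finite_imageD[OF finite_subset[OF sub Lf] inj] .
  have "card (ml_solutions X V y) \<le> card ?L"
    using card_mono[OF Lf sub] card_image[OF inj] by simp
  also have "\<dots> + 1 \<le> 2 * card {i \<in> K. l i \<noteq> 0} + card {j. j < n \<and> m j \<noteq> 0}"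
    using L(2) i0 j0 real.finite_K by simp
  finally show "card (ml_solutions X V y) + 1 \<le> 2 * card {i \<in> K. l i \<noteq> 0} + card {j. j < n \<and> m j \<noteq> 0}"
    by simp
qed

text \<open>The squared length of A'v equals v'(AA'v) = 0. Through this, a nonzero design guarantees
  a nonzero eigenvalue.\<close>

lemma gram_nonzero:
  fixes A :: "real mat"
  assumes A: "A \<in> carrier_mat n q" and AA: "A * transpose_mat A = 0\<^sub>m n n"
  shows "transpose_mat A = 0\<^sub>m q n"
proof (rule mat_eq_by_mult_vec[of _ q n])
  fix v :: "real Matrix.vec" assume v: "v \<in> carrier_vec n"
  have T: "transpose_mat A \<in> carrier_mat q n" using A by simp
  have Tv: "transpose_mat A *\<^sub>v v \<in> carrier_vec q" by (rule mult_mat_vec_carrier[OF T v])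
  have "(transpose_mat A *\<^sub>v v) \<bullet> (transpose_mat A *\<^sub>v v) = v \<bullet> (A *\<^sub>v (transpose_mat A *\<^sub>v v))"
    by (rule transpose_vec_mult_scalar[OF A Tv v])
  also have "A *\<^sub>v (transpose_mat A *\<^sub>v v) = 0\<^sub>m n n *\<^sub>v v"
    unfolding AA[symmetric] by (rule assoc_mult_mat_vec[OF A T v, symmetric])
  also have "\<dots> = 0\<^sub>v n" using v by (intro eq_vecI) auto
  finally have "transpose_mat A *\<^sub>v v = 0\<^sub>v q"
    using scalar_prod_self_eq_0[OF Tv] v by simp
  also have "\<dots> = 0\<^sub>m q n *\<^sub>v v" using v by (intro eq_vecI) auto
  finally show "transpose_mat A *\<^sub>v v = 0\<^sub>m q n *\<^sub>v v" .
qed (use A in auto)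

lemma ml_degree_bound:
  fixes X Z :: "real mat"
  assumes X: "X \<in> carrier_mat n p" and rank: "vec_space.rank n X = p"
    and Z: "Z \<in> carrier_mat n q" and nz: "Z * transpose_mat Z \<noteq> 0\<^sub>m n n"
    and g: "g \<in> carrier_vec q" "g \<noteq> 0\<^sub>v q" "Z *\<^sub>v g \<in> column_space X"
    and proper: "column_space (append_columns X (Z * transpose_mat Z)) \<subset> carrier_vec n"
  shows "ml_degree_le X (Z * transpose_mat Z) (3 * q - 3)"
proof -
  let ?V = "Z * transpose_mat Z"
  define G where "G = pseudoinverse X"
  define M where "M = 1\<^sub>m n - X * G"
  have inv: "is_pseudoinverse X G" "G * X = 1\<^sub>m p"
    unfolding G_def using pseudoinverse_left_inverse[OF X] full_rank_injective[OF X rank] by blast+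
  note Mf = residual_projection_facts[OF X inv(1)[unfolded G_def], folded G_def, folded M_def]
  have G: "G \<in> carrier_mat p n" using inv(1) X by (auto simp: is_pseudoinverse_def)
  obtain Q K l where basis: "residual_eigenbasis Q n M ?V K l"
    using residual_eigenbasis_exists[OF Mf(1,2,4) Z] by blast
  interpret residual_eigenbasis Q n M ?V K l by fact
  obtain P m where P: "orthonormal_mat P n" and VP: "?V = conj_diag P m"
    using symmetric_conj_diag[OF V] by blast
  interpret p: orthonormal_mat P n by fact
  obtain i0 where i0: "i0 \<in> K" "l i0 = 0"
    using column_space_append_eq_carrier[OF basis _ X G Mf(5)] proper by blast
  obtain j0 where j0: "j0 < n" "m j0 \<noteq> 0"
    using p.conj_diag_eq_0[of m] nz VP by auto
  \<comment> \<open>Since \<open>M\<close> is symmetric, the compression M V M is the Gram product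
    of \<open>M * Z\<close>. This matrix annihilates \<open>g\<close>, because \<open>M\<close>
    annihilates the column space of \<open>X\<close>; one of the \<open>q\<close> dimensions is
    lost.\<close>
  have r: "card {i \<in> K. l i \<noteq> 0} + 1 \<le> q"
  proof (rule card_nonzero_eigenvalues_le(2)[of "M * Z" n])
    show MZ: "M * Z \<in> carrier_mat n q" using Mf(1) Z by simp
    have "(M * Z) * transpose_mat (M * Z) = M * ?V * M"
    proof -
      have T: "transpose_mat Z \<in> carrier_mat q n" using Z by simp
      have "(M * Z) * transpose_mat (M * Z) = (M * Z) * (transpose_mat Z * M)"
        unfolding transpose_mult[OF Mf(1) Z] Mf(2) ..
      also have "\<dots> = M * Z * transpose_mat Z * M" by (rule assoc_mult_mat[OF MZ T Mf(1), symmetric])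
      also have "M * Z * transpose_mat Z = M * ?V" by (rule assoc_mult_mat[OF Mf(1) Z T])
      finally show ?thesis .
    qed
    then show "((M * Z) * transpose_mat (M * Z)) *\<^sub>v col Q i = l i \<cdot>\<^sub>v col Q i" if "i \<in> {i \<in> K. l i \<noteq> 0}" for i
      using eigen that by simp
    obtain \<gamma> where \<gamma>: "\<gamma> \<in> carrier_vec p" "X *\<^sub>v \<gamma> = Z *\<^sub>v g"
      using g(3) mem_column_space_iff[OF X] by blast
    have "(M * Z) *\<^sub>v g = M *\<^sub>v (Z *\<^sub>v g)" by (rule assoc_mult_mat_vec[OF Mf(1) Z g(1)])
    also have "\<dots> = (M * X) *\<^sub>v \<gamma>"
      unfolding \<gamma>(2)[symmetric] by (rule assoc_mult_mat_vec[OF Mf(1) X \<gamma>(1), symmetric])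
    also have "\<dots> = 0\<^sub>v n" unfolding Mf(3) using \<gamma>(1) by (intro eq_vecI) auto
    finally show "(M * Z) *\<^sub>v g = 0\<^sub>v n" .
    show "col Q i \<bullet> col Q j = (if i = j then 1 else 0)"
      if "i \<in> {i \<in> K. l i \<noteq> 0}" "j \<in> {i \<in> K. l i \<noteq> 0}" for i j
      using that K by (intro col_orthonormal) auto
  qed (use g finite_K in auto)
  \<comment> \<open>For V = ZZ' itself no kernel vector of \<open>Z\<close> is at hand, so only the
    bound \<open>q\<close> results.\<close>
  have a: "card {j. j < n \<and> m j \<noteq> 0} \<le> q"
  proof (rule card_nonzero_eigenvalues_le(1)[OF Z, where e = "col P" and l = m])
    show "?V *\<^sub>v col P i = m i \<cdot>\<^sub>v col P i" if "i \<in> {j. j < n \<and> m j \<noteq> 0}" for i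
      unfolding VP using that by (intro p.conj_diag_eigenvector) simp
    show "col P i \<bullet> col P j = (if i = j then 1 else 0)"
      if "i \<in> {j. j < n \<and> m j \<noteq> 0}" "j \<in> {j. j < n \<and> m j \<noteq> 0}" for i j
      using that by (intro p.col_orthonormal) auto
  qed auto
  have dim: "dim_row X = n" using X by simp
  have "AE y in Pi\<^sub>M {..<n} (\<lambda>_. lborel). \<forall>c\<in>col Q ` {..<n}. c \<bullet> Matrix.vec n y \<noteq> 0"
    by (rule AE_scalar_prod_nonzero) (auto, metis col_nonzero)
  then show ?thesis unfolding ml_degree_le_def dim
  proof eventually_elim
    case (elim y)
    have "col Q i \<bullet> Matrix.vec n y \<noteq> 0" if "i \<in> K" for i using elim that K by auto
    note c = ml_solutions_count[OF basis P VP X G inv(2) Mf(3) M_def vec_carrier this i0 j0]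
    show ?case using c r a by auto
  qed
qed

lemma reml_degree_bound:
  fixes X Z :: "real mat"
  assumes X: "X \<in> carrier_mat n p" and rank: "vec_space.rank n X = p"
    and Z: "Z \<in> carrier_mat n q"
    and g: "g \<in> carrier_vec q" "g \<noteq> 0\<^sub>v q" "Z *\<^sub>v g \<in> column_space X"
  defines "M \<equiv> 1\<^sub>m n - X * pseudoinverse X"
  assumes proper: "column_space (M * (Z * transpose_mat Z)) \<subset> column_space M"
    and nz: "M * (Z * transpose_mat Z) \<noteq> 0\<^sub>m n n"
  shows "reml_degree_le X (Z * transpose_mat Z) (2 * q - 3)"
  unfolding reml_degree_le_def
proof (intro ballI impI, elim conjE)
  let ?V = "Z * transpose_mat Z" and ?G = "pseudoinverse X"
  define k where "k = dim_row X - dim_col X"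
  fix B assume B0: "B \<in> carrier_mat (dim_row X - dim_col X) (dim_row X)"
    and BB0: "B * transpose_mat B = 1\<^sub>m (dim_row X - dim_col X)"
    and BM0: "transpose_mat B * B = residual_projection X"
  have inv: "is_pseudoinverse X (pseudoinverse X)"
    using pseudoinverse_left_inverse(1)[OF X] full_rank_injective[OF X rank] by blast
  note M = residual_projection_facts[OF X inv, folded M_def]
  have B: "B \<in> carrier_mat k n" and BB: "B * transpose_mat B = 1\<^sub>m k" and BM: "transpose_mat B * B = M"
    using B0 BB0 BM0 X by (auto simp: k_def residual_projection_def M_def)
  have T: "transpose_mat B \<in> carrier_mat n k" using B by simp
  have TZ: "transpose_mat Z \<in> carrier_mat q n" using Z by simp
  have V: "?V \<in> carrier_mat n n" using Z by simp
  define A where "A = B * Z"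
  have A: "A \<in> carrier_mat k q" using B Z by (simp add: A_def)
  define U where "U = B * ?V * transpose_mat B"
  have UA: "U = A * transpose_mat A"
  proof -
    have "A * transpose_mat A = (B * Z) * (transpose_mat Z * transpose_mat B)"
      unfolding A_def transpose_mult[OF B Z] ..
    also have "\<dots> = B * Z * transpose_mat Z * transpose_mat B"
      by (rule assoc_mult_mat[OF A[unfolded A_def] TZ T, symmetric])
    also have "B * Z * transpose_mat Z = B * ?V" by (rule assoc_mult_mat[OF B Z TZ])
    finally show ?thesis by (simp add: U_def)
  qed
  have TA: "transpose_mat A \<in> carrier_mat q k" using A by simp
  have U: "U \<in> carrier_mat k k" and Us: "transpose_mat U = U"
    unfolding UA using A transpose_mult[OF A TA] by simp_all
  obtain Q l where oQ: "orthonormal_mat Q k" and UQ: "U = conj_diag Q l"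
    using symmetric_conj_diag[OF U Us] by blast
  interpret orthonormal_mat Q k by fact
  \<comment> \<open>B = BB'B = BM, so \<open>B\<close> annihilates whatever \<open>M\<close>
    does.\<close>
  have "B * X = 0\<^sub>m k p"
  proof -
    have "B * X = (B * transpose_mat B) * (B * X)" unfolding BB using B X by simp
    also have "\<dots> = B * (transpose_mat B * (B * X))"
      using B X by (intro assoc_mult_mat[OF B T]) auto
    also have "transpose_mat B * (B * X) = M * X"
      unfolding BM[symmetric] by (rule assoc_mult_mat[OF T B X, symmetric])
    also have "B * (M * X) = 0\<^sub>m k p" using M(3) B by simp
    finally show ?thesis .
  qed
  have Ag: "A *\<^sub>v g = 0\<^sub>v k"
  proof -
    obtain \<gamma> where \<gamma>: "\<gamma> \<in> carrier_vec p" "X *\<^sub>v \<gamma> = Z *\<^sub>v g"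
      using g(3) mem_column_space_iff[OF X] by blast
    have "A *\<^sub>v g = B *\<^sub>v (X *\<^sub>v \<gamma>)"
      unfolding A_def \<gamma>(2) by (rule assoc_mult_mat_vec[OF B Z g(1)])
    also have "\<dots> = (B * X) *\<^sub>v \<gamma>" by (rule assoc_mult_mat_vec[OF B X \<gamma>(1), symmetric])
    also have "\<dots> = 0\<^sub>v k" unfolding \<open>B * X = 0\<^sub>m k p\<close> using \<gamma>(1) by (intro eq_vecI) auto
    finally show ?thesis .
  qed
  have r: "card {i. i < k \<and> l i \<noteq> 0} + 1 \<le> q"
  proof (rule card_nonzero_eigenvalues_le(2)[OF A, where e = "col Q" and l = l])
    show "(A * transpose_mat A) *\<^sub>v col Q i = l i \<cdot>\<^sub>v col Q i" if "i \<in> {i. i < k \<and> l i \<noteq> 0}" for i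
      unfolding UA[symmetric] UQ using that by (intro conj_diag_eigenvector) simp
    show "col Q i \<bullet> col Q j = (if i = j then 1 else 0)"
      if "i \<in> {i. i < k \<and> l i \<noteq> 0}" "j \<in> {i. i < k \<and> l i \<noteq> 0}" for i j
      using that by (intro col_orthonormal) auto
  qed (use g Ag in auto)
  \<comment> \<open>If all eigenvalues vanished, the Gram product \<open>U\<close> of BZ would be 0,
    hence BZ = 0 and M V = B'(BZ)Z' = 0.\<close>
  have "\<exists>j0<k. l j0 \<noteq> 0"
  proof (rule ccontr)
    assume "\<not> ?thesis"
    then have "U = 0\<^sub>m k k" unfolding UQ by (intro conj_diag_eq_0) auto
    then have "transpose_mat A = 0\<^sub>m q k" using gram_nonzero[OF A] UA by simp
    then have "transpose_mat (transpose_mat A) = 0\<^sub>m k q" by simp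
    then have A0: "B * Z = 0\<^sub>m k q" by (simp add: A_def)
    have "M * ?V = transpose_mat B * (B * ?V)"
      unfolding BM[symmetric] by (rule assoc_mult_mat[OF T B V])
    also have "B * ?V = B * Z * transpose_mat Z" by (rule assoc_mult_mat[OF B Z TZ, symmetric])
    also have "transpose_mat B * \<dots> = 0\<^sub>m n n" unfolding A0 using TZ T by simp
    finally show False using nz by simp
  qed
  then obtain j0 where j0: "j0 < k" "l j0 \<noteq> 0" by blast
  \<comment> \<open>An invertible \<open>U\<close> would place each M v in the column space of M V:
    with c = U^{-1} B v one gets M v = B'B v = B'U c = M V (B'c).\<close>
  have "\<exists>i0<k. l i0 = 0"
  proof (rule ccontr)
    assume "\<not> ?thesis"
    then have inv: "conj_diag Q l * conj_diag Q (\<lambda>i. 1 / l i) = 1\<^sub>m k"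
      by (intro conj_diag_inverse) auto
    have "column_space M \<subseteq> column_space (M * ?V)"
    proof
      fix x assume "x \<in> column_space M"
      then obtain v where v: "v \<in> carrier_vec n" "M *\<^sub>v v = x"
        using mem_column_space_iff[OF M(1)] by blast
      define c where "c = conj_diag Q (\<lambda>i. 1 / l i) *\<^sub>v (B *\<^sub>v v)"
      have Bv: "B *\<^sub>v v \<in> carrier_vec k" by (rule mult_mat_vec_carrier[OF B v(1)])
      have c: "c \<in> carrier_vec k" unfolding c_def by (rule mult_mat_vec_carrier[OF conj_diag_carrier Bv])
      have Tc: "transpose_mat B *\<^sub>v c \<in> carrier_vec n" by (rule mult_mat_vec_carrier[OF T c])
      have BV: "B * ?V \<in> carrier_mat k n" using B V by simp
      have "B *\<^sub>v v = U *\<^sub>v c"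
        unfolding c_def UQ assoc_mult_mat_vec[OF conj_diag_carrier conj_diag_carrier Bv, symmetric] inv
        using Bv by simp
      also have "\<dots> = (B * ?V) *\<^sub>v (transpose_mat B *\<^sub>v c)"
        unfolding U_def by (rule assoc_mult_mat_vec[OF BV T c])
      finally have e: "B *\<^sub>v v = (B * ?V) *\<^sub>v (transpose_mat B *\<^sub>v c)" .
      have "x = transpose_mat B *\<^sub>v (B *\<^sub>v v)"
        unfolding v(2)[symmetric] BM[symmetric] by (rule assoc_mult_mat_vec[OF T B v(1)])
      also have "\<dots> = (transpose_mat B * (B * ?V)) *\<^sub>v (transpose_mat B *\<^sub>v c)"
        unfolding e by (rule assoc_mult_mat_vec[OF T BV Tc, symmetric])
      also have "transpose_mat B * (B * ?V) = M * ?V"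
        unfolding BM[symmetric] by (rule assoc_mult_mat[OF T B V, symmetric])
      finally have "x = (M * ?V) *\<^sub>v (transpose_mat B *\<^sub>v c)" .
      then show "x \<in> column_space (M * ?V)"
        using mem_column_space_iff[OF mult_carrier_mat[OF M(1) V]] Tc by auto
    qed
    with proper show False by blast
  qed
  then obtain i0 where i0: "i0 < k" "l i0 = 0" by blast
  have "centered_ml_degree_le U (2 * q - 3)"
    unfolding UQ
  proof (rule centered_ml_degree_conj_diag[OF oQ i0 j0])
    \<comment> \<open>A nonzero eigenvalue together with \<open>r\<close> gives
      \<open>q \<ge> 2\<close>, so that \<open>2 * q - 3\<close> is a true difference.\<close>
    have "card {i. i < k \<and> l i \<noteq> 0} > 0" using j0 by (auto simp: card_gt_0_iff)
    then show "2 * card {i. i < k \<and> l i \<noteq> 0} \<le> 2 * q - 3 + 1" using r by linarith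
  qed
  then show "centered_ml_degree_le (B * ?V * transpose_mat B) (2 * q - 3)" unfolding U_def .
qed

text \<open>The condition that \<open>M * V\<close> is nonzero in the second part excludes the case
  B V B' = 0, which arises when the columns of \<open>Z\<close> lie in the column space of
  \<open>X\<close>. There \<sigma>_1^2 is unconstrained and no finite bound can hold.\<close>

theorem theorem5p1:
  fixes q n p :: nat and ns :: "nat list" and Z W X V M :: "real mat"
  assumes "q \<ge> 2"
    and "length ns = q"
    and "\<forall>k<q. ns ! k \<ge> 1"
    and "n = (\<Sum>k<q. ns ! k)"
    and "Z = group_design ns"
    and "W \<in> carrier_mat n p"
    and "vec_space.rank n W = p"
    and "p < n"
    and "ones_vec n \<in> column_space W"
    and "X = W"
    and "V = Z * transpose_mat Z"
    and "M = 1\<^sub>m n - X * pseudoinverse X"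
  shows "(column_space (append_columns X V) \<subset> carrier_vec n
            \<longrightarrow> ml_degree_le X V (3 * q - 3))
       \<and> (column_space (M * V) \<subset> column_space M \<and> M * V \<noteq> 0\<^sub>m n n
            \<longrightarrow> reml_degree_le X V (2 * q - 3))"
proof -
  have n: "n = sum_list ns" using assms(2,4) by (simp add: sum_list_sum_nth atLeast0LessThan)
  have Z: "Z \<in> carrier_mat n q" and Zones: "Z *\<^sub>v ones_vec q = ones_vec n"
    using group_design_carrier[of ns] group_design_mult_ones[of ns] assms(2,5) n by auto
  have ones: "ones_vec k \<in> carrier_vec k" for k by (simp add: ones_vec_def)
  have ones_nz: "ones_vec k \<noteq> 0\<^sub>v k" if "k > 0" for k
  proof
    assume "ones_vec k = 0\<^sub>v k"
    then have "ones_vec k $ 0 = 0\<^sub>v k $ 0" by simp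
    then show False using that by (simp add: ones_vec_def)
  qed
  \<comment> \<open>\<open>Z\<close> maps the all-ones vector to the nonzero all-ones vector, so
    \<open>Z\<close> and with it ZZ' is nonzero.\<close>
  have "V \<noteq> 0\<^sub>m n n"
  proof
    assume "V = 0\<^sub>m n n"
    then have "transpose_mat Z = 0\<^sub>m q n" using gram_nonzero[OF Z] assms(11) by simp
    then have "transpose_mat (transpose_mat Z) = 0\<^sub>m n q" by simp
    then have "ones_vec n = 0\<^sub>m n q *\<^sub>v ones_vec q" using Zones by simp
    also have "\<dots> = 0\<^sub>v n" using ones by (intro eq_vecI) auto
    finally show False using ones_nz[of n] assms(8) by simp
  qed
  moreover have "ones_vec q \<noteq> 0\<^sub>v q" using ones_nz[of q] assms(1) by simp
  moreover have "Z *\<^sub>v ones_vec q \<in> column_space X" using assms(9,10) Zones by simp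
  ultimately show ?thesis
    using ml_degree_bound[of X n p Z q "ones_vec q"] reml_degree_bound[of X n p Z q "ones_vec q"]
      Z ones assms(6,7,10-12) by simp
qed

end
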